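(* For $z\in\mathbb{C}$ with $-\frac12<\mathrm{Re}(z)<\frac12$, $w\in\mathbb{C}$, and $|\arg x|<\frac{\pi}{4}$, $$K_{z,w}(2x)=\frac12\sum_{n=-\infty}^{\infty}(-1)^nK_{z+n}(2x)\left(I_{2n}(2w\sqrt{x})+J_{2n}(2w\sqrt{x})\right).$$
   Context: The generalized modified Bessel function (two subscripts) is defined, for $z,w\in\mathbb{C}$, by $$K_{z,w}(x):=\frac{1}{2\pi i}\int_{c-i\infty}^{c+i\infty}\Gamma\left(\tfrac{s-z}{2}\right)\Gamma\left(\tfrac{s+z}{2}\right)\,{}_1F_1\left(\tfrac{s-z}{2};\tfrac12;-\tfrac{w^2}{4}\right){}_1F_1\left(\tfrac{s+z}{2};\tfrac12;-\tfrac{w^2}{4}\right)2^{s-2}x^{-s}\,ds,$$ where $c=\mathrm{Re}(s)>|\mathrm{Re}(z)|$ and powers of $x$ are principal. Here ${}_1F_1(a;c;u)=\sum_{n\ge0}\frac{(a)_n u^n}{(c)_n n!}$ with $(a)_n=a(a+1)\cdots(a+n-1)$. $J_\nu$ is the Bessel function of the first kind, and $I_\nu$, $K_\nu$ (single subscript) are the modified Bessel functions of the first and second kinds, with the usual limiting definition of $K_\nu$ at integer orders. *)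

theory Defs
  imports "HOL-Analysis.Analysis"
begin

definition hyp1F1 :: "complex \<Rightarrow> complex \<Rightarrow> complex \<Rightarrow> complex" where
  "hyp1F1 a c u = (\<Sum>n. pochhammer a n * u ^ n / (pochhammer c n * fact n))"

(* Principal power with a ^ 0 = 1 also at a = 0 (the library has 0 powr 0 = 0), so that
   J_0(0) = I_0(0) = 1 below.  For integer exponents and nonzero base this is the
   ordinary integer power. *)
definition principal_pow :: "complex \<Rightarrow> complex \<Rightarrow> complex" where
  "principal_pow a \<nu> = (if \<nu> = 0 then 1 else a powr \<nu>)"

(* rGamma is the entire function 1 / Gamma, hence the negative integer orders are covered. *)
definition bessel_J :: "complex \<Rightarrow> complex \<Rightarrow> complex" where
  "bessel_J \<nu> y = principal_pow (y / 2) \<nu> *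
     (\<Sum>m. (- 1) ^ m * (y / 2) ^ (2 * m) * rGamma (\<nu> + of_nat m + 1) / fact m)"

definition bessel_I :: "complex \<Rightarrow> complex \<Rightarrow> complex" where
  "bessel_I \<nu> y = principal_pow (y / 2) \<nu> *
     (\<Sum>m. (y / 2) ^ (2 * m) * rGamma (\<nu> + of_nat m + 1) / fact m)"

definition bessel_K_nonint :: "complex \<Rightarrow> complex \<Rightarrow> complex" where
  "bessel_K_nonint \<nu> y =
     of_real pi / 2 * (bessel_I (- \<nu>) y - bessel_I \<nu> y) / sin (\<nu> * of_real pi)"

definition bessel_K :: "complex \<Rightarrow> complex \<Rightarrow> complex" where
  "bessel_K \<nu> y =
     (if \<nu> \<in> \<int> then Lim (at \<nu>) (\<lambda>\<mu>. bessel_K_nonint \<mu> y) else bessel_K_nonint \<nu> y)"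

definition gen_bessel_K_integrand ::
    "complex \<Rightarrow> complex \<Rightarrow> complex \<Rightarrow> complex \<Rightarrow> complex" where
  "gen_bessel_K_integrand z w x s =
     Gamma ((s - z) / 2) * Gamma ((s + z) / 2) *
     hyp1F1 ((s - z) / 2) (1 / 2) (- (w ^ 2 / 4)) *
     hyp1F1 ((s + z) / 2) (1 / 2) (- (w ^ 2 / 4)) *
     2 powr (s - 2) * x powr (- s)"

(* The two-subscript function K_{z,w}(x), with the abscissa c of the line of integration
   as an explicit parameter (admissible when c > |Re z|).  The line is parametrized by
   s = c + i t, so that ds = i dt. *)
definition gen_bessel_K :: "real \<Rightarrow> complex \<Rightarrow> complex \<Rightarrow> complex \<Rightarrow> complex" where
  "gen_bessel_K c z w x =
     1 / (2 * of_real pi * \<i>) *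
     (LINT t|lborel. gen_bessel_K_integrand z w x (Complex c t) * \<i>)"

end

theory Submission
  imports Defs "HOL-Complex_Analysis.Residue_Theorem"
begin

text \<open>
  Two facts combine. First, \<open>Gamma a * hyp1F1 a (1/2) (- w\<^sup>2/4)\<close> is the series of
  \<open>Gamma (a + n) (- w\<^sup>2)\<^sup>n / (2 n)!\<close>. Multiplying out the two such series in the integrand of
  \<open>K\<^bsub>z,w\<^esub> (2 x)\<close> produces products \<open>Gamma ((s - z)/2 + m) Gamma ((s + z)/2 + n)\<close>, and these are the
  Gamma factors of the classical Mellin-Barnes integral

    \<open>K\<^sub>\<nu> X = 1/(2 \<pi> \<i>) \<integral> Gamma ((s - \<nu>)/2) Gamma ((s + \<nu>)/2) 2\<^bsup>s - 2\<^esup> X\<^bsup>- s\<^esup> ds\<close>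

  with \<open>s\<close> replaced by \<open>s + m + n\<close> and \<open>\<nu> = z + n - m\<close>. Integrating term by term gives

    \<open>K\<^bsub>z,w\<^esub> (2 x) = \<Sum>\<^bsub>m,n\<^esub> (- w\<^sup>2 x)\<^bsup>m + n\<^esup> / ((2 m)! (2 n)!) K\<^bsub>z + n - m\<^esub> (2 x)\<close>.

  Second, in \<open>I\<^bsub>2N\<^esub> (2 u) + J\<^bsub>2N\<^esub> (2 u)\<close> the odd terms cancel, and what remains is twice the sum of
  \<open>u\<^bsup>2 (m + n)\<^esup> / ((2 m)! (2 n)!)\<close> over \<open>n - m = N\<close> (\<open>bessel_series_diagonal\<close>). With
  \<open>u = w \<surd>x\<close>, summing the double series along the diagonals \<open>n - m = N\<close> is the claim.

  The analytic work lies in the Mellin-Barnes integral and in the term by term integration. Both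
  rest on one estimate, \<open>\<bar>Gamma a\<bar> \<le> Gamma (Re a) 2\<^bsup>Re a / 2\<^esup> exp (- \<pi> \<bar>Im a\<bar> / 4)\<close> for \<open>Re a > 0\<close>
  (\<open>norm_Gamma_decay\<close>). The two Gamma factors at half the height decay together like
  \<open>exp (- \<pi> \<bar>Im s\<bar> / 4)\<close>, which dominates \<open>\<bar>x\<^bsup>- s\<^esup>\<bar>\<close> precisely when \<open>\<bar>Arg x\<bar> < \<pi> / 4\<close>. The constant
  is mild enough that the double series is dominated by a convergent product series times a fixed
  integrable function of the height.

  The Mellin-Barnes integral is evaluated for \<open>\<nu> \<notin> \<int>\<close> by moving the line of integration to the
  left (\<open>barnes_integral_nonint\<close>): the residues at \<open>\<nu> - 2 l\<close> and \<open>- \<nu> - 2 l\<close> are the terms of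
  the series of \<open>I\<^bsub>- \<nu>\<^esub>\<close> and \<open>I\<^sub>\<nu>\<close>. For integer \<open>\<nu>\<close> both sides are limits of their values at nearby
  orders (\<open>barnes_integral_eq_bessel_K\<close>).
\<close>

section \<open>Exponential decay of the Gamma function on vertical lines\<close>

lemma norm_Gamma_le_Gamma_Re:
  fixes a :: complex
  assumes "Re a > 0"
  shows "norm (Gamma a) \<le> Gamma (Re a)"
proof -
  have "norm (integral {0..} (\<lambda>t. of_real t powr (a - 1) / of_real (exp t)))
      \<le> integral {0..} (\<lambda>t. t powr (Re a - 1) / exp t)"
  proof (rule integral_norm_bound_integral)
    show "(\<lambda>t. of_real t powr (a - 1) / of_real (exp t)) integrable_on {0..}"
      using Gamma_integral_complex[OF assms] by blast
    show "(\<lambda>t. t powr (Re a - 1) / exp t) integrable_on {0..}"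
      using Gamma_integral_real[of "Re a"] assms by blast
    fix t :: real assume "t \<in> {0..}"
    thus "norm (of_real t powr (a - 1) / of_real (exp t)) \<le> t powr (Re a - 1) / exp t"
      by (simp add: norm_divide norm_powr_real_powr)
  qed
  thus ?thesis
    using Gamma_integral_complex[OF assms] Gamma_integral_real[of "Re a"] assms
    by (simp add: integral_unique)
qed

text \<open>
  A primitive of \<open>u \<mapsto> ln (1 + t\<^sup>2 / u\<^sup>2)\<close> on the positive axis. It is needed because
  \<open>\<bar>Gamma (u + \<i> t + 1) / Gamma (u + \<i> t)\<bar>\<^sup>2\<close> equals \<open>u\<^sup>2 (1 + t\<^sup>2 / u\<^sup>2)\<close>, so that this logarithm
  measures how the quotient \<open>\<bar>Gamma (u + \<i> t)\<bar> / Gamma u\<close> changes when \<open>u\<close> increases by 1.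
\<close>
definition log_primitive :: "real \<Rightarrow> real \<Rightarrow> real" where
  "log_primitive t u = u * ln (1 + t\<^sup>2 / u\<^sup>2) + 2 * t * arctan (u / t)"

lemma log_primitive_deriv:
  assumes "t > 0" "u > 0"
  shows "(log_primitive t has_real_derivative ln (1 + t\<^sup>2 / u\<^sup>2)) (at u)"
proof -
  have pos: "1 + t\<^sup>2 / u\<^sup>2 > 0" using assms by (simp add: add_pos_nonneg)
  have "((\<lambda>u. 1 + t\<^sup>2 / u\<^sup>2) has_real_derivative - (2 * t\<^sup>2 / u ^ 3)) (at u)"
    using assms by (auto intro!: derivative_eq_intros simp: power2_eq_square power3_eq_cube mult_ac)
  from DERIV_chain2[OF DERIV_ln[OF pos] this]
  have ln: "((\<lambda>u. ln (1 + t\<^sup>2 / u\<^sup>2)) has_real_derivative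
      inverse (1 + t\<^sup>2 / u\<^sup>2) * - (2 * t\<^sup>2 / u ^ 3)) (at u)" .
  have "((\<lambda>u. u / t) has_real_derivative 1 / t) (at u)"
    using assms by (auto intro!: derivative_eq_intros)
  from DERIV_chain2[OF DERIV_arctan this]
  have at: "((\<lambda>u. arctan (u / t)) has_real_derivative inverse (1 + (u / t)\<^sup>2) * (1 / t)) (at u)" .
  have "((\<lambda>u. u * ln (1 + t\<^sup>2 / u\<^sup>2) + 2 * t * arctan (u / t)) has_real_derivative
      (1 * ln (1 + t\<^sup>2 / u\<^sup>2) + inverse (1 + t\<^sup>2 / u\<^sup>2) * - (2 * t\<^sup>2 / u ^ 3) * u)
      + 2 * t * (inverse (1 + (u / t)\<^sup>2) * (1 / t))) (at u)"
    by (intro DERIV_add DERIV_mult DERIV_cmult DERIV_ident ln at)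
  also have "inverse (1 + t\<^sup>2 / u\<^sup>2) * - (2 * t\<^sup>2 / u ^ 3) * u = - (2 * t\<^sup>2 / (t\<^sup>2 + u\<^sup>2))"
  proof -
    have "inverse (1 + t\<^sup>2 / u\<^sup>2) = u\<^sup>2 / (t\<^sup>2 + u\<^sup>2)"
      using assms by (simp add: field_simps)
    thus ?thesis using assms by (simp add: power2_eq_square power3_eq_cube)
  qed
  also have "2 * t * (inverse (1 + (u / t)\<^sup>2) * (1 / t)) = 2 * t\<^sup>2 / (t\<^sup>2 + u\<^sup>2)"
  proof -
    have "inverse (1 + (u / t)\<^sup>2) = t\<^sup>2 / (t\<^sup>2 + u\<^sup>2)"
      using assms by (simp add: field_simps)
    thus ?thesis using assms by (simp add: power2_eq_square)
  qed
  finally show ?thesis by (simp add: log_primitive_def[abs_def])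
qed

text \<open>
  The integrand decreases in \<open>u\<close>, so its mean over \<open>[u, u + 1]\<close> is at most its value at the
  left end point.
\<close>
lemma log_primitive_increment:
  assumes "t > 0" "u > 0"
  shows "log_primitive t (u + 1) - log_primitive t u \<le> ln (1 + t\<^sup>2 / u\<^sup>2)"
proof -
  have "\<exists>v. u < v \<and> v < u + 1 \<and>
      log_primitive t (u + 1) - log_primitive t u = (u + 1 - u) * ln (1 + t\<^sup>2 / v\<^sup>2)"
    by (rule MVT2) (use assms log_primitive_deriv in auto)
  then obtain v where v: "u < v"
    "log_primitive t (u + 1) - log_primitive t u = ln (1 + t\<^sup>2 / v\<^sup>2)" by auto
  have "t\<^sup>2 / v\<^sup>2 \<le> t\<^sup>2 / u\<^sup>2"
    using v assms by (intro divide_left_mono power_mono) auto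
  thus ?thesis using v assms by (simp add: add_pos_nonneg)
qed

text \<open>
  The difference of the two sides has derivative \<open>ln (1 + t\<^sup>2 / u\<^sup>2) - ln 2\<close>, which changes sign
  from plus to minus at \<open>u = t\<close>, where both sides agree.
\<close>
lemma log_primitive_le_tangent:
  assumes "t > 0" "u > 0"
  shows "log_primitive t u \<le> pi * t / 2 + u * ln 2"
proof -
  define f where "f = (\<lambda>u. log_primitive t u - u * ln 2)"
  have deriv: "(f has_real_derivative ln (1 + t\<^sup>2 / v\<^sup>2) - ln 2) (at v)" if "v > 0" for v
    unfolding f_def using log_primitive_deriv[OF assms(1) that]
    by (auto intro!: derivative_eq_intros)
  have "f u \<le> f t"
  proof (cases "u \<le> t")
    case True
    show ?thesis
    proof (rule DERIV_nonneg_imp_nondecreasing[OF True])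
      fix v assume v: "u \<le> v" "v \<le> t"
      hence "v\<^sup>2 \<le> t\<^sup>2" using assms by (intro power_mono) auto
      hence "1 + t\<^sup>2 / v\<^sup>2 \<ge> 2" using v assms by (simp add: divide_simps)
      hence "ln (1 + t\<^sup>2 / v\<^sup>2) - ln 2 \<ge> 0" by simp
      thus "\<exists>y. (f has_real_derivative y) (at v) \<and> 0 \<le> y" using deriv[of v] v assms by fastforce
    qed
  next
    case False
    hence "t \<le> u" by simp
    thus ?thesis
    proof (rule DERIV_nonpos_imp_nonincreasing)
      fix v assume v: "t \<le> v" "v \<le> u"
      hence "t\<^sup>2 \<le> v\<^sup>2" using assms by (intro power_mono) auto
      hence "1 + t\<^sup>2 / v\<^sup>2 \<le> 2" using v assms by (simp add: divide_simps)
      moreover have "1 + t\<^sup>2 / v\<^sup>2 > 0" by (simp add: add_pos_nonneg)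
      ultimately have "ln (1 + t\<^sup>2 / v\<^sup>2) - ln 2 \<le> 0" by simp
      thus "\<exists>y. (f has_real_derivative y) (at v) \<and> y \<le> 0" using deriv[of v] v assms by fastforce
    qed
  qed
  also have "f t = pi * t / 2"
    using assms by (simp add: f_def log_primitive_def arctan_one)
  finally show ?thesis by (simp add: f_def)
qed

text \<open>
  Iterating the functional equation \<open>n\<close> times and estimating each factor \<open>1 + t\<^sup>2 / u\<^sup>2\<close> from below
  by an increment of \<open>log_primitive\<close> gives a telescoping sum; at the far end the trivial
  estimate \<open>\<bar>Gamma a\<bar> \<le> Gamma (Re a)\<close> is used.
\<close>
lemma norm_Gamma_le_telescope:
  fixes a :: complex
  assumes "Re a > 0" "Im a > 0"
  shows "norm (Gamma a) \<le> Gamma (Re a) *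
    exp ((log_primitive (Im a) (Re a) - log_primitive (Im a) (Re a + real n)) / 2)"
  using assms
proof (induction n arbitrary: a)
  case 0
  thus ?case using norm_Gamma_le_Gamma_Re by simp
next
  case (Suc n)
  define H where "H = log_primitive (Im a)"
  have a: "a \<notin> \<int>\<^sub>\<le>\<^sub>0" "Re a \<notin> \<int>\<^sub>\<le>\<^sub>0"
    using Suc.prems by (auto elim!: nonpos_Ints_cases)
  have na: "norm a = Re a * sqrt (1 + (Im a)\<^sup>2 / (Re a)\<^sup>2)"
  proof -
    have "Re a * sqrt (1 + (Im a)\<^sup>2 / (Re a)\<^sup>2) = sqrt ((Re a)\<^sup>2 * (1 + (Im a)\<^sup>2 / (Re a)\<^sup>2))"
      using Suc.prems by (simp add: real_sqrt_mult)
    also have "(Re a)\<^sup>2 * (1 + (Im a)\<^sup>2 / (Re a)\<^sup>2) = (Re a)\<^sup>2 + (Im a)\<^sup>2"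
      using Suc.prems by (simp add: field_simps)
    finally show ?thesis by (simp add: cmod_def)
  qed
  have s: "sqrt (1 + (Im a)\<^sup>2 / (Re a)\<^sup>2) \<ge> exp ((H (Re a + 1) - H (Re a)) / 2)"
  proof -
    have p: "1 + (Im a)\<^sup>2 / (Re a)\<^sup>2 > 0" by (simp add: add_pos_nonneg)
    have "exp ((H (Re a + 1) - H (Re a)) / 2) \<le> exp (ln (1 + (Im a)\<^sup>2 / (Re a)\<^sup>2) / 2)"
      using log_primitive_increment[of "Im a" "Re a"] Suc.prems by (simp add: H_def)
    also have "\<dots> = sqrt (1 + (Im a)\<^sup>2 / (Re a)\<^sup>2)"
      using p by (simp add: ln_sqrt[symmetric])
    finally show ?thesis .
  qed
  have "norm a * norm (Gamma a) = norm (Gamma (a + 1))"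
    using a by (simp add: Gamma_plus1 norm_mult)
  also have "\<dots> \<le> Gamma (Re a + 1) * exp ((H (Re a + 1) - H (Re a + 1 + real n)) / 2)"
    using Suc.IH[of "a + 1"] Suc.prems by (simp add: H_def)
  also have "\<dots> = Re a * Gamma (Re a) * exp ((H (Re a) - H (Re a + real (Suc n))) / 2)
      * exp ((H (Re a + 1) - H (Re a)) / 2)"
  proof -
    have "exp ((H (Re a + 1) - H (Re a + 1 + real n)) / 2) =
        exp ((H (Re a) - H (Re a + real (Suc n))) / 2 + (H (Re a + 1) - H (Re a)) / 2)"
      by (rule arg_cong[of _ _ exp]) (simp add: add_ac field_simps)
    thus ?thesis using a by (simp add: Gamma_plus1 exp_add)
  qed
  also have "\<dots> \<le> Re a * Gamma (Re a) * exp ((H (Re a) - H (Re a + real (Suc n))) / 2)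
      * sqrt (1 + (Im a)\<^sup>2 / (Re a)\<^sup>2)"
    using s Suc.prems by (intro mult_left_mono mult_nonneg_nonneg) (auto simp: less_imp_le)
  also have "\<dots> = norm a * (Gamma (Re a) * exp ((H (Re a) - H (Re a + real (Suc n))) / 2))"
    unfolding na by (simp only: mult_ac)
  finally show ?case
    using Suc.prems a by (subst (asm) mult_le_cancel_left_pos) (auto simp: H_def)
qed

text \<open>
  As \<open>n\<close> tends to infinity, \<open>log_primitive t (\<sigma> + n)\<close> is at least \<open>2 t arctan ((\<sigma> + n) / t)\<close>, which
  tends to \<open>\<pi> t\<close>, and the tangent estimate bounds \<open>log_primitive t \<sigma>\<close>. Half of the true rate of
  decay \<open>\<pi> / 2\<close> is given up here, in exchange for a factor that grows only geometrically with the
  real part; this is what makes the estimate summable along \<open>a, a + 1, a + 2, \<dots>\<close>. The rate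
  \<open>\<pi> / 4\<close> is what a sector \<open>\<bar>Arg x\<bar> < \<pi> / 4\<close> requires.
\<close>
lemma norm_Gamma_decay:
  fixes a :: complex
  assumes "Re a > 0"
  shows "norm (Gamma a) \<le> Gamma (Re a) * 2 powr (Re a / 2) * exp (- (pi * \<bar>Im a\<bar> / 4))"
proof -
  have up: "norm (Gamma b) \<le> Gamma (Re b) * 2 powr (Re b / 2) * exp (- (pi * Im b / 4))"
    if b: "Re b > 0" "Im b > 0" for b :: complex
  proof -
    define H where "H = log_primitive (Im b)"
    have "norm (Gamma b) \<le> Gamma (Re b) * exp ((H (Re b) - 2 * Im b * arctan ((Re b + real n) / Im b)) / 2)" for n
    proof -
      have "H (Re b + real n) \<ge> 2 * Im b * arctan ((Re b + real n) / Im b)"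
        unfolding H_def log_primitive_def using b by simp
      hence "Gamma (Re b) * exp ((H (Re b) - H (Re b + real n)) / 2) \<le>
         Gamma (Re b) * exp ((H (Re b) - 2 * Im b * arctan ((Re b + real n) / Im b)) / 2)"
        using b by (intro mult_left_mono) (auto simp: less_imp_le)
      thus ?thesis using norm_Gamma_le_telescope[OF b, of n] by (simp add: H_def)
    qed
    moreover have "(\<lambda>n. Gamma (Re b) * exp ((H (Re b) - 2 * Im b * arctan ((Re b + real n) / Im b)) / 2))
      \<longlonglongrightarrow> Gamma (Re b) * exp ((H (Re b) - 2 * Im b * (pi / 2)) / 2)"
    proof -
      have "filterlim (\<lambda>n. (1 / Im b) * (Re b + real n)) at_top sequentially"
        using b by (intro filterlim_tendsto_pos_mult_at_top[OF tendsto_const] filterlim_tendsto_add_at_top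
            tendsto_const filterlim_real_sequentially) auto
      hence "(\<lambda>n. arctan ((Re b + real n) / Im b)) \<longlonglongrightarrow> pi / 2"
        by (intro filterlim_compose[OF tendsto_arctan_at_top]) auto
      thus ?thesis by (intro tendsto_intros) auto
    qed
    ultimately have "norm (Gamma b) \<le> Gamma (Re b) * exp ((H (Re b) - 2 * Im b * (pi / 2)) / 2)"
      by (intro LIMSEQ_le_const) auto
    also have "\<dots> \<le> Gamma (Re b) * exp ((pi * Im b / 2 + Re b * ln 2 - 2 * Im b * (pi / 2)) / 2)"
      using log_primitive_le_tangent[of "Im b" "Re b"] b
      by (intro mult_left_mono) (auto simp: less_imp_le H_def)
    also have "exp ((pi * Im b / 2 + Re b * ln 2 - 2 * Im b * (pi / 2)) / 2) =
        2 powr (Re b / 2) * exp (- (pi * Im b / 4))"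
      by (simp add: powr_def exp_add[symmetric] field_simps)
    finally show ?thesis by (simp add: mult.assoc)
  qed
  consider "Im a > 0" | "Im a = 0" | "Im a < 0" by linarith
  thus ?thesis
  proof cases
    case 1
    thus ?thesis using up[of a] assms by simp
  next
    case 2
    have "norm (Gamma a) \<le> Gamma (Re a) * 1" using norm_Gamma_le_Gamma_Re[OF assms] by simp
    also have "\<dots> \<le> Gamma (Re a) * 2 powr (Re a / 2)"
      using assms by (intro mult_left_mono) (auto simp: less_imp_le intro!: ge_one_powr_ge_zero)
    finally show ?thesis using 2 by simp
  next
    case 3
    have "norm (Gamma (cnj a)) = norm (Gamma a)"
      by (subst cnj_Gamma[symmetric]) simp
    thus ?thesis using up[of "cnj a"] assms 3 by simp
  qed
qed

lemma norm_pochhammer_ge_real: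
  fixes a :: complex
  shows "norm (pochhammer a n) \<ge> norm (pochhammer (Re a) n)"
  unfolding pochhammer_prod prod_norm[symmetric] 
proof (rule prod_mono)
  fix i show "0 \<le> norm (Re a + of_nat i) \<and> norm (Re a + of_nat i) \<le> norm (a + of_nat i)"
    using abs_Re_le_cmod[of "a + of_nat i"] by simp
qed

text \<open>
  The functional equation carries the estimate to the left half plane: each division by \<open>a + i\<close>
  costs at most a division by its real part, and these real divisions reproduce \<open>Gamma (Re a)\<close>.
  The last argument has real part at most \<open>\<bar>Re a\<bar> + 1\<close>, whence the exponent of 2. The factor
  \<open>Gamma (Re a)\<close> decays super-exponentially as \<open>Re a\<close> tends to minus infinity away from
  the poles.
\<close>
lemma norm_Gamma_decay_all:
  fixes a :: complex
  assumes "Re a \<notin> \<int>\<^sub>\<le>\<^sub>0"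
  shows "norm (Gamma a) \<le>
    \<bar>Gamma (Re a)\<bar> * 2 powr ((\<bar>Re a\<bar> + 1) / 2) * exp (- (pi * \<bar>Im a\<bar> / 4))"
proof -
  define p where "p = (if Re a > 0 then 0 else nat (\<lfloor>- Re a\<rfloor> + 1))"
  have p: "Re a + real p > 0" "Re a + real p \<le> \<bar>Re a\<bar> + 1"
    unfolding p_def by (auto simp: le_nat_floor) linarith+
  have a: "a \<notin> \<int>\<^sub>\<le>\<^sub>0" using assms by (auto elim!: nonpos_Ints_cases simp: nonpos_Ints_of_int)
  have Gp: "Gamma (Re a + real p) > 0" using p by simp
  have "norm (Gamma a) * Gamma (Re a + real p) = norm (Gamma a) * (norm (pochhammer (Re a) p) * \<bar>Gamma (Re a)\<bar>)"
    using pochhammer_Gamma[OF assms, of p] assms Gp by (simp add: Gamma_eq_zero_iff abs_divide abs_of_pos)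
  also have "\<dots> \<le> norm (Gamma a) * (norm (pochhammer a p) * \<bar>Gamma (Re a)\<bar>)"
    using norm_pochhammer_ge_real[of a p] by (intro mult_left_mono mult_right_mono) auto
  also have "\<dots> = norm (Gamma (a + of_nat p)) * \<bar>Gamma (Re a)\<bar>"
    using pochhammer_Gamma[OF a, of p] a by (simp add: Gamma_eq_zero_iff norm_divide)
  also have "\<dots> \<le> (Gamma (Re a + real p) * 2 powr ((Re a + real p) / 2) * exp (- (pi * \<bar>Im a\<bar> / 4))) * \<bar>Gamma (Re a)\<bar>"
    using norm_Gamma_decay[of "a + of_nat p"] p by (intro mult_right_mono) auto
  also have "\<dots> = Gamma (Re a + real p) * (2 powr ((Re a + real p) / 2) * (exp (- (pi * \<bar>Im a\<bar> / 4)) * \<bar>Gamma (Re a)\<bar>))"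
    by (simp only: mult_ac)
  also have "\<dots> \<le> Gamma (Re a + real p) * (2 powr ((\<bar>Re a\<bar> + 1) / 2) * (exp (- (pi * \<bar>Im a\<bar> / 4)) * \<bar>Gamma (Re a)\<bar>))"
    using Gp p by (intro mult_left_mono mult_right_mono powr_mono) auto
  finally have "Gamma (Re a + real p) * norm (Gamma a) \<le> Gamma (Re a + real p) * (\<bar>Gamma (Re a)\<bar> * 2 powr ((\<bar>Re a\<bar> + 1) / 2) * exp (- (pi * \<bar>Im a\<bar> / 4)))"
    by (simp add: mult_ac)
  thus ?thesis using Gp by (subst (asm) mult_le_cancel_left_pos) auto
qed

text \<open>
  Away from the real axis no pole interferes, so a vertical distance of 1 suffices to move
  an estimate to the left uniformly in the real part. This serves the horizontal sides of the
  contour, which cross the abscissae of the poles.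
\<close>
lemma norm_Gamma_le_shift:
  fixes a :: complex
  assumes "\<bar>Im a\<bar> \<ge> 1"
  shows "norm (Gamma a) \<le> norm (Gamma (a + of_nat p))"
proof -
  have a: "a \<notin> \<int>\<^sub>\<le>\<^sub>0" using assms by (auto elim!: nonpos_Ints_cases)
  have "1 \<le> norm (pochhammer a p)"
    unfolding pochhammer_prod prod_norm[symmetric]
  proof (rule prod_ge_1)
    fix i show "1 \<le> norm (a + of_nat i)"
      using abs_Im_le_cmod[of "a + of_nat i"] assms by simp
  qed
  hence "norm (Gamma a) * 1 \<le> norm (Gamma a) * norm (pochhammer a p)"
    by (intro mult_left_mono) auto
  also have "\<dots> = norm (Gamma (a + of_nat p))"
    using pochhammer_Gamma[OF a, of p] a by (simp add: Gamma_eq_zero_iff norm_divide)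
  finally show ?thesis by simp
qed

section \<open>The Mellin-Barnes kernel of K on vertical lines\<close>

lemma integrable_exp_neg_abs:
  fixes e :: real
  assumes "e > 0"
  shows "integrable lborel (\<lambda>t::real. exp (- (e * \<bar>t\<bar>)))"
proof -
  have "(\<lambda>t::real. exp (- e * t)) integrable_on {0..}"
    by (rule integrable_on_exp_minus_to_infinity[OF assms])
  hence "(\<lambda>t::real. exp (- e * t)) absolutely_integrable_on {0..}"
    by (intro nonnegative_absolutely_integrable_1) auto
  hence "integrable lborel (\<lambda>t::real. indicator {0..} t * exp (- e * t))"
    by (simp add: set_integrable_def integrable_completion)
  note 1 = this
  from lborel_integrable_real_affine[OF this, of "-1" 0]
  have "integrable lborel (\<lambda>t::real. indicator {0..} (- t) * exp (e * t))"
    by simp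
  from Bochner_Integration.integrable_add[OF 1 this] show ?thesis
    by (rule Bochner_Integration.integrable_bound) (auto simp: indicator_def)
qed

lemma integral_symmetric_interval_tendsto:
  fixes f :: "real \<Rightarrow> complex"
  assumes f: "integrable lborel f"
  shows "((\<lambda>T. integral {-T..T} f) \<longlongrightarrow> (LINT t|lborel. f t)) at_top"
proof -
  have "((\<lambda>T. LINT t|lborel. indicator {-T..T} t *\<^sub>R f t) \<longlongrightarrow> (LINT t|lborel. f t)) at_top"
  proof (rule integral_dominated_convergence_at_top)
    show "integrable lborel (\<lambda>t. norm (f t))" using f by simp
    show "AE t in lborel. ((\<lambda>T. indicator {-T..T} t *\<^sub>R f t) \<longlongrightarrow> f t) at_top"
    proof (rule AE_I2)
      fix t :: real
      have "eventually (\<lambda>T. indicator {-T..T} t *\<^sub>R f t = f t) at_top"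
        using eventually_ge_at_top[of "\<bar>t\<bar>"] by eventually_elim (auto simp: indicator_def)
      thus "((\<lambda>T. indicator {-T..T} t *\<^sub>R f t) \<longlongrightarrow> f t) at_top"
        by (rule tendsto_eventually)
    qed
  qed (use f in \<open>auto simp: indicator_def\<close>)
  moreover have "(LINT t|lborel. indicator {-T..T} t *\<^sub>R f t) = integral {-T..T} f" for T
  proof -
    have "set_integrable lborel {-T..T} f"
      unfolding set_integrable_def using integrable_mult_indicator[OF _ f, of "{-T..T}"] by simp
    from set_borel_integral_eq_integral(2)[OF this] show ?thesis
      by (simp add: set_lebesgue_integral_def)
  qed
  ultimately show ?thesis by simp
qed

text \<open>
  The integrand of the Mellin-Barnes representation of \<open>K\<^sub>\<nu> X\<close>, with \<open>L = Ln (X / 2)\<close> in place of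
  \<open>X\<close>: then \<open>2\<^bsup>s - 2\<^esup> X\<^bsup>- s\<^esup>\<close> becomes \<open>exp (- s L) / 4\<close>, and the condition on the argument of \<open>X\<close>
  becomes one on \<open>Im L\<close>.
\<close>
definition barnes_kernel :: "complex \<Rightarrow> complex \<Rightarrow> complex \<Rightarrow> complex" where
  "barnes_kernel \<nu> L s = Gamma ((s - \<nu>) / 2) * Gamma ((s + \<nu>) / 2) * exp (- (s * L)) / 4"

lemma barnes_kernel_uminus: "barnes_kernel (- \<nu>) L = barnes_kernel \<nu> L"
  by (simp add: barnes_kernel_def fun_eq_iff mult.commute)

lemma exp_vertical_bound:
  "norm (exp (- (Complex \<sigma> t * L))) \<le> exp (- (\<sigma> * Re L)) * exp (\<bar>Im L\<bar> * \<bar>t\<bar>)"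
proof -
  have "t * Im L \<le> \<bar>Im L\<bar> * \<bar>t\<bar>" by (metis abs_ge_self abs_mult mult.commute)
  thus ?thesis by (simp flip: exp_add)
qed

text \<open>
  The imaginary shifts of the two Gamma factors cancel, since \<open>2 \<bar>t\<bar> \<le> \<bar>t - y\<bar> + \<bar>t + y\<bar>\<close>.
\<close>
lemma exp_decay_product_le:
  fixes t y :: real
  shows "exp (- (pi * \<bar>(t - y) / 2\<bar> / 4)) * exp (- (pi * \<bar>(t + y) / 2\<bar> / 4)) \<le> exp (- (pi / 4 * \<bar>t\<bar>))"
proof -
  have "\<bar>t\<bar> \<le> \<bar>(t - y) / 2\<bar> + \<bar>(t + y) / 2\<bar>"
    using abs_triangle_ineq[of "t - y" "t + y"] by (simp add: abs_mult field_simps)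
  hence "pi / 4 * \<bar>t\<bar> \<le> pi / 4 * (\<bar>(t - y) / 2\<bar> + \<bar>(t + y) / 2\<bar>)"
    by (intro mult_left_mono) auto
  thus ?thesis by (simp add: algebra_simps flip: exp_add)
qed

text \<open>
  Decay \<open>exp (- \<pi> \<bar>t\<bar> / 4)\<close> from the two Gamma factors together against growth
  \<open>exp (\<bar>Im L\<bar> \<bar>t\<bar>)\<close> from the power.
\<close>
lemma barnes_kernel_bound:
  assumes "(\<sigma> - Re \<nu>) / 2 \<notin> \<int>\<^sub>\<le>\<^sub>0" "(\<sigma> + Re \<nu>) / 2 \<notin> \<int>\<^sub>\<le>\<^sub>0"
  shows "norm (barnes_kernel \<nu> L (Complex \<sigma> t)) \<le>
    \<bar>Gamma ((\<sigma> - Re \<nu>) / 2)\<bar> * \<bar>Gamma ((\<sigma> + Re \<nu>) / 2)\<bar> *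
    2 powr ((\<bar>\<sigma>\<bar> + \<bar>Re \<nu>\<bar>) / 2 + 1) * exp (- (\<sigma> * Re L)) * exp (- ((pi / 4 - \<bar>Im L\<bar>) * \<bar>t\<bar>))"
proof -
  define a where "a = (Complex \<sigma> t - \<nu>) / 2"
  define b where "b = (Complex \<sigma> t + \<nu>) / 2"
  have ab: "Re a = (\<sigma> - Re \<nu>) / 2" "Im a = (t - Im \<nu>) / 2"
           "Re b = (\<sigma> + Re \<nu>) / 2" "Im b = (t + Im \<nu>) / 2"
    by (simp_all add: a_def b_def)
  have "norm (barnes_kernel \<nu> L (Complex \<sigma> t)) \<le> norm (Gamma a) * norm (Gamma b) * norm (exp (- (Complex \<sigma> t * L)))"
    by (simp add: barnes_kernel_def a_def b_def norm_mult norm_divide)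
  also have "\<dots> \<le> (\<bar>Gamma (Re a)\<bar> * 2 powr ((\<bar>Re a\<bar> + 1) / 2) * exp (- (pi * \<bar>Im a\<bar> / 4))) *
      (\<bar>Gamma (Re b)\<bar> * 2 powr ((\<bar>Re b\<bar> + 1) / 2) * exp (- (pi * \<bar>Im b\<bar> / 4))) *
      (exp (- (\<sigma> * Re L)) * exp (\<bar>Im L\<bar> * \<bar>t\<bar>))"
    using assms by (intro mult_mono norm_Gamma_decay_all exp_vertical_bound) (auto simp: ab)
  also have "\<dots> = \<bar>Gamma (Re a)\<bar> * \<bar>Gamma (Re b)\<bar> * exp (- (\<sigma> * Re L)) * exp (\<bar>Im L\<bar> * \<bar>t\<bar>) *
      (2 powr ((\<bar>Re a\<bar> + 1) / 2 + (\<bar>Re b\<bar> + 1) / 2) * (exp (- (pi * \<bar>Im a\<bar> / 4)) * exp (- (pi * \<bar>Im b\<bar> / 4))))"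
    by (simp only: powr_add mult_ac)
  also have "\<dots> \<le> \<bar>Gamma (Re a)\<bar> * \<bar>Gamma (Re b)\<bar> * exp (- (\<sigma> * Re L)) * exp (\<bar>Im L\<bar> * \<bar>t\<bar>) *
      (2 powr ((\<bar>\<sigma>\<bar> + \<bar>Re \<nu>\<bar>) / 2 + 1) * exp (- (pi / 4 * \<bar>t\<bar>)))"
  proof (intro mult_left_mono mult_mono powr_mono)
    show "(\<bar>Re a\<bar> + 1) / 2 + (\<bar>Re b\<bar> + 1) / 2 \<le> (\<bar>\<sigma>\<bar> + \<bar>Re \<nu>\<bar>) / 2 + 1"
      using abs_triangle_ineq[of \<sigma> "Re \<nu>"] abs_triangle_ineq4[of \<sigma> "Re \<nu>"] unfolding ab by (simp add: field_simps)
    show "exp (- (pi * \<bar>Im a\<bar> / 4)) * exp (- (pi * \<bar>Im b\<bar> / 4)) \<le> exp (- (pi / 4 * \<bar>t\<bar>))"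
      unfolding ab by (rule exp_decay_product_le)
  qed auto
  also have "\<dots> = \<bar>Gamma (Re a)\<bar> * \<bar>Gamma (Re b)\<bar> * 2 powr ((\<bar>\<sigma>\<bar> + \<bar>Re \<nu>\<bar>) / 2 + 1) * exp (- (\<sigma> * Re L)) *
     (exp (\<bar>Im L\<bar> * \<bar>t\<bar>) * exp (- (pi / 4 * \<bar>t\<bar>)))"
    by (simp only: mult_ac)
  also have "exp (\<bar>Im L\<bar> * \<bar>t\<bar>) * exp (- (pi / 4 * \<bar>t\<bar>)) = exp (- ((pi / 4 - \<bar>Im L\<bar>) * \<bar>t\<bar>))"
    by (simp add: algebra_simps flip: exp_add)
  finally show ?thesis by (simp only: ab)
qed

lemma nonpos_Ints_Re: "a \<in> \<int>\<^sub>\<le>\<^sub>0 \<Longrightarrow> Re a \<in> \<int>\<^sub>\<le>\<^sub>0"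
  by (auto elim!: nonpos_Ints_cases simp: nonpos_Ints_of_int)

lemma continuous_on_barnes_kernel_line:
  assumes "(\<sigma> - Re \<nu>) / 2 \<notin> \<int>\<^sub>\<le>\<^sub>0" "(\<sigma> + Re \<nu>) / 2 \<notin> \<int>\<^sub>\<le>\<^sub>0"
  shows "continuous_on UNIV (\<lambda>t. barnes_kernel \<nu> L (Complex \<sigma> t))"
proof -
  have "(of_real \<sigma> + \<i> * of_real t - \<nu>) / 2 \<notin> \<int>\<^sub>\<le>\<^sub>0"
    "(of_real \<sigma> + \<i> * of_real t + \<nu>) / 2 \<notin> \<int>\<^sub>\<le>\<^sub>0" for t
    using nonpos_Ints_Re[of "(of_real \<sigma> + \<i> * of_real t - \<nu>) / 2"]
      nonpos_Ints_Re[of "(of_real \<sigma> + \<i> * of_real t + \<nu>) / 2"] assms by auto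
  thus ?thesis
    unfolding barnes_kernel_def Complex_eq by (intro continuous_at_imp_continuous_on ballI continuous_intros) auto
qed

lemma integrable_barnes_kernel:
  assumes "(\<sigma> - Re \<nu>) / 2 \<notin> \<int>\<^sub>\<le>\<^sub>0" "(\<sigma> + Re \<nu>) / 2 \<notin> \<int>\<^sub>\<le>\<^sub>0" and L: "\<bar>Im L\<bar> < pi / 4"
  shows "integrable lborel (\<lambda>t. barnes_kernel \<nu> L (Complex \<sigma> t))"
    and "norm (LINT t|lborel. barnes_kernel \<nu> L (Complex \<sigma> t)) \<le>
      \<bar>Gamma ((\<sigma> - Re \<nu>) / 2)\<bar> * \<bar>Gamma ((\<sigma> + Re \<nu>) / 2)\<bar> *
      2 powr ((\<bar>\<sigma>\<bar> + \<bar>Re \<nu>\<bar>) / 2 + 1) * exp (- (\<sigma> * Re L)) *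
      (LINT t|lborel. exp (- ((pi / 4 - \<bar>Im L\<bar>) * \<bar>t\<bar>)))"
proof -
  define C where "C = \<bar>Gamma ((\<sigma> - Re \<nu>) / 2)\<bar> * \<bar>Gamma ((\<sigma> + Re \<nu>) / 2)\<bar> *
      2 powr ((\<bar>\<sigma>\<bar> + \<bar>Re \<nu>\<bar>) / 2 + 1) * exp (- (\<sigma> * Re L))"
  have C: "C \<ge> 0" by (simp add: C_def)
  have bound: "norm (barnes_kernel \<nu> L (Complex \<sigma> t)) \<le> C * exp (- ((pi / 4 - \<bar>Im L\<bar>) * \<bar>t\<bar>))" for t
    unfolding C_def by (rule barnes_kernel_bound) fact+
  have E: "integrable lborel (\<lambda>t. C * exp (- ((pi / 4 - \<bar>Im L\<bar>) * \<bar>t\<bar>)))"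
    using L by (intro integrable_mult_right integrable_exp_neg_abs) auto
  show int: "integrable lborel (\<lambda>t. barnes_kernel \<nu> L (Complex \<sigma> t))"
  proof (rule Bochner_Integration.integrable_bound[OF E])
    show "(\<lambda>t. barnes_kernel \<nu> L (Complex \<sigma> t)) \<in> borel_measurable lborel"
      using borel_measurable_continuous_onI[OF continuous_on_barnes_kernel_line[OF assms(1,2)]] by simp
    show "AE t in lborel. norm (barnes_kernel \<nu> L (Complex \<sigma> t)) \<le> norm (C * exp (- ((pi / 4 - \<bar>Im L\<bar>) * \<bar>t\<bar>)))"
      using bound C by (intro AE_I2) (simp add: abs_mult)
  qed
  have "norm (LINT t|lborel. barnes_kernel \<nu> L (Complex \<sigma> t)) \<le> (LINT t|lborel. C * exp (- ((pi / 4 - \<bar>Im L\<bar>) * \<bar>t\<bar>)))"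
    by (rule Bochner_Integration.integral_norm_bound_integral[OF int E bound])
  thus "norm (LINT t|lborel. barnes_kernel \<nu> L (Complex \<sigma> t)) \<le>
      \<bar>Gamma ((\<sigma> - Re \<nu>) / 2)\<bar> * \<bar>Gamma ((\<sigma> + Re \<nu>) / 2)\<bar> *
      2 powr ((\<bar>\<sigma>\<bar> + \<bar>Re \<nu>\<bar>) / 2 + 1) * exp (- (\<sigma> * Re L)) *
      (LINT t|lborel. exp (- ((pi / 4 - \<bar>Im L\<bar>) * \<bar>t\<bar>)))"
    by (simp add: C_def)
qed

text \<open>
  A bound uniform over a whole strip, poles included, once \<open>\<bar>t\<bar>\<close> is so large that both Gamma factors
  are evaluated at distance at least 1 from the real axis. It makes the horizontal sides of the
  rectangles vanish in the limit.
\<close>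
lemma barnes_kernel_strip_bound:
  obtains C where "C \<ge> 0"
    "\<And>\<sigma> t. \<sigma> \<in> {d..c} \<Longrightarrow> \<bar>t\<bar> \<ge> \<bar>Im \<nu>\<bar> + 2 \<Longrightarrow>
      norm (barnes_kernel \<nu> L (Complex \<sigma> t)) \<le> C * exp (- ((pi / 4 - \<bar>Im L\<bar>) * \<bar>t\<bar>))"
proof -
  \<comment> \<open>\<open>p\<close> steps to the right bring every argument into the region where real parts are at least 1.\<close>
  obtain p where p: "real p \<ge> 1 - (d - \<bar>Re \<nu>\<bar>) / 2" using real_arch_simple by blast
  define B where "B = (c + \<bar>Re \<nu>\<bar>) / 2 + real p"
  have "continuous_on {1..B} (Gamma :: real \<Rightarrow> real)"
    by (intro continuous_intros) (auto elim!: nonpos_Ints_cases)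
  from compact_imp_bounded[OF compact_continuous_image[OF this compact_Icc]]
  obtain G where G: "G > 0" "\<And>u. u \<in> {1..B} \<Longrightarrow> Gamma u \<le> G"
    unfolding bounded_pos by fastforce
  define A where "A = G * 2 powr (B / 2)"
  have A: "A > 0" using G by (simp add: A_def)
  have gb: "norm (Gamma a) \<le> A * exp (- (pi * \<bar>Im a\<bar> / 4))"
    if a: "Re a \<ge> (d - \<bar>Re \<nu>\<bar>) / 2" "Re a \<le> (c + \<bar>Re \<nu>\<bar>) / 2" "\<bar>Im a\<bar> \<ge> 1" for a
  proof -
    have r: "Re a + real p \<in> {1..B}" using a p by (simp add: B_def field_simps)
    have "norm (Gamma a) \<le> norm (Gamma (a + of_nat p))" by (rule norm_Gamma_le_shift[OF a(3)])
    also have "\<dots> \<le> Gamma (Re a + real p) * 2 powr ((Re a + real p) / 2) * exp (- (pi * \<bar>Im a\<bar> / 4))"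
      using norm_Gamma_decay[of "a + of_nat p"] r by simp
    also have "\<dots> \<le> G * 2 powr (B / 2) * exp (- (pi * \<bar>Im a\<bar> / 4))"
      using r G by (intro mult_mono powr_mono) auto
    finally show ?thesis by (simp add: A_def)
  qed
  define E where "E = exp ((\<bar>c\<bar> + \<bar>d\<bar>) * \<bar>Re L\<bar>)"
  have main: "norm (barnes_kernel \<nu> L (Complex \<sigma> t)) \<le> (A * A * E) * exp (- ((pi / 4 - \<bar>Im L\<bar>) * \<bar>t\<bar>))"
    if s: "\<sigma> \<in> {d..c}" "\<bar>t\<bar> \<ge> \<bar>Im \<nu>\<bar> + 2" for \<sigma> t
  proof -
    define a where "a = (Complex \<sigma> t - \<nu>) / 2"
    define b where "b = (Complex \<sigma> t + \<nu>) / 2"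
    have ab: "Re a = (\<sigma> - Re \<nu>) / 2" "Im a = (t - Im \<nu>) / 2"
             "Re b = (\<sigma> + Re \<nu>) / 2" "Im b = (t + Im \<nu>) / 2"
      by (simp_all add: a_def b_def)
    have "norm (barnes_kernel \<nu> L (Complex \<sigma> t)) \<le> norm (Gamma a) * norm (Gamma b) * norm (exp (- (Complex \<sigma> t * L)))"
      by (simp add: barnes_kernel_def a_def b_def norm_mult norm_divide)
    also have "\<dots> \<le> (A * exp (- (pi * \<bar>Im a\<bar> / 4))) * (A * exp (- (pi * \<bar>Im b\<bar> / 4))) *
        (E * exp (\<bar>Im L\<bar> * \<bar>t\<bar>))"
    proof (intro mult_mono gb)
      have "- (\<sigma> * Re L) \<le> \<bar>\<sigma>\<bar> * \<bar>Re L\<bar>" by (metis abs_ge_minus_self abs_mult)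
      also have "\<dots> \<le> (\<bar>c\<bar> + \<bar>d\<bar>) * \<bar>Re L\<bar>" using s by (intro mult_right_mono) auto
      finally have "exp (- (\<sigma> * Re L)) \<le> E" by (simp add: E_def)
      hence "exp (- (\<sigma> * Re L)) * exp (\<bar>Im L\<bar> * \<bar>t\<bar>) \<le> E * exp (\<bar>Im L\<bar> * \<bar>t\<bar>)" by simp
      with exp_vertical_bound[of \<sigma> t L] 
      show "norm (exp (- (Complex \<sigma> t * L))) \<le> E * exp (\<bar>Im L\<bar> * \<bar>t\<bar>)" by linarith
    qed (use s A in \<open>auto simp: ab\<close>)
    also have "\<dots> = A * A * E * exp (\<bar>Im L\<bar> * \<bar>t\<bar>) * (exp (- (pi * \<bar>Im a\<bar> / 4)) * exp (- (pi * \<bar>Im b\<bar> / 4)))"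
      by (simp only: mult_ac)
    also have "\<dots> \<le> A * A * E * exp (\<bar>Im L\<bar> * \<bar>t\<bar>) * exp (- (pi / 4 * \<bar>t\<bar>))"
      unfolding ab using A by (intro mult_left_mono exp_decay_product_le) (auto simp: E_def)
    also have "\<dots> = A * A * E * exp (- ((pi / 4 - \<bar>Im L\<bar>) * \<bar>t\<bar>))"
      by (simp add: algebra_simps flip: exp_add)
    finally show ?thesis .
  qed
  show ?thesis by (rule that[OF _ main]) (use A in \<open>auto simp: E_def\<close>)
qed

section \<open>Residues and shifting the line of integration\<close>

lemma barnes_kernel_holomorphic:
  assumes "\<And>s l. s \<in> A \<Longrightarrow> s \<noteq> \<nu> - 2 * of_nat l"
    and "\<And>s l. s \<in> A \<Longrightarrow> s \<noteq> - \<nu> - 2 * of_nat l"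
  shows "barnes_kernel \<nu> L holomorphic_on A"
proof -
  have *: "(s - \<nu>) / 2 \<notin> \<int>\<^sub>\<le>\<^sub>0" "(s + \<nu>) / 2 \<notin> \<int>\<^sub>\<le>\<^sub>0" if "s \<in> A" for s
  proof -
    have "s = \<nu> - 2 * of_nat l" if "(s - \<nu>) / 2 = - of_nat l" for l
      using that by (simp add: field_simps)
    moreover have "s = - \<nu> - 2 * of_nat l" if "(s + \<nu>) / 2 = - of_nat l" for l
      using that by (simp add: field_simps eq_neg_iff_add_eq_0)
    ultimately show "(s - \<nu>) / 2 \<notin> \<int>\<^sub>\<le>\<^sub>0" "(s + \<nu>) / 2 \<notin> \<int>\<^sub>\<le>\<^sub>0"
      using assms that by (auto elim!: nonpos_Ints_cases')
  qed
  show ?thesis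
    unfolding barnes_kernel_def[abs_def] using * by (intro holomorphic_intros) auto
qed

text \<open>
  For \<open>\<nu> \<notin> \<int>\<close> the poles \<open>\<nu> - 2 l\<close> of the first Gamma factor and \<open>- \<nu> - 2 l\<close> of the second are
  distinct, hence simple. The residues at the second family follow from \<open>barnes_kernel_uminus\<close>.
\<close>
lemma barnes_kernel_residue:
  assumes \<nu>: "\<nu> \<notin> \<int>"
  shows "residue (barnes_kernel \<nu> L) (\<nu> - 2 * of_nat l) =
    (- 1) ^ l / fact l * Gamma (\<nu> - of_nat l) * exp (- ((\<nu> - 2 * of_nat l) * L)) / 2"
proof (rule residue_simple')
  define p where "p = \<nu> - 2 * of_nat l"
  define S where "S = (\<lambda>s. (s - \<nu>) / 2) -` (- (\<int>\<^sub>\<le>\<^sub>0 - {- of_nat l})) \<inter> (\<lambda>s. (s + \<nu>) / 2) -` (- \<int>\<^sub>\<le>\<^sub>0)"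
  have half: "(p - \<nu>) / 2 = - of_nat l" "(p + \<nu>) / 2 = \<nu> - of_nat l"
    by (simp_all add: p_def field_simps)
  have nl: "\<nu> - of_nat l \<notin> \<int>"
    using \<nu> Ints_add[of "\<nu> - of_nat l" "of_nat l"] by auto
  hence nl': "\<nu> - of_nat l \<notin> \<int>\<^sub>\<le>\<^sub>0" using nonpos_Ints_subset_Ints by auto
  have nl2: "(p + \<nu>) / 2 \<notin> \<int>\<^sub>\<le>\<^sub>0" using nl' by (simp only: half not_False_eq_True)
  show "open S" unfolding S_def
    by (intro open_Int open_vimage open_Compl closed_subset_Ints continuous_intros) auto
  show "\<nu> - 2 * of_nat l \<in> S"
    unfolding S_def p_def[symmetric] using nl' by (simp add: half)
  show "barnes_kernel \<nu> L holomorphic_on S - {\<nu> - 2 * of_nat l}"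
  proof (rule barnes_kernel_holomorphic)
    fix s j assume s: "s \<in> S - {\<nu> - 2 * of_nat l}"
    show "s \<noteq> \<nu> - 2 * of_nat j"
      using s by (auto simp: S_def)
    show "s \<noteq> - \<nu> - 2 * of_nat j"
      using s by (auto simp: S_def)
  qed
  have "filterlim (\<lambda>s. (s - \<nu>) / 2) (at (- of_nat l)) (at p)"
  proof -
    have "((\<lambda>s. (s - \<nu>) / 2) \<longlongrightarrow> (p - \<nu>) / 2) (at p)" by (intro tendsto_intros) auto
    moreover have "eventually (\<lambda>s. (s - \<nu>) / 2 \<noteq> - of_nat l) (at p)"
      unfolding half(1)[symmetric] by (auto simp: eventually_at_filter)
    ultimately show ?thesis unfolding half by (simp add: filterlim_at)
  qed
  from filterlim_compose[OF Gamma_residues this]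
  have 1: "((\<lambda>s. Gamma ((s - \<nu>) / 2) * ((s - \<nu>) / 2 + of_nat l)) \<longlongrightarrow> (- 1) ^ l / fact l) (at p)" .
  have 2: "((\<lambda>s. Gamma ((s + \<nu>) / 2) * exp (- (s * L)) / 2) \<longlongrightarrow> Gamma ((p + \<nu>) / 2) * exp (- (p * L)) / 2) (at p)"
    using nl2 by (intro tendsto_intros) auto
  from tendsto_mult[OF 1 2]
  have "((\<lambda>s. barnes_kernel \<nu> L s * (s - p)) \<longlongrightarrow>
      (- 1) ^ l / fact l * (Gamma ((p + \<nu>) / 2) * exp (- (p * L)) / 2)) (at p)"
  proof (rule Lim_transform_eventually)
    show "\<forall>\<^sub>F s in at p. Gamma ((s - \<nu>) / 2) * ((s - \<nu>) / 2 + of_nat l) * (Gamma ((s + \<nu>) / 2) * exp (- (s * L)) / 2) =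
       barnes_kernel \<nu> L s * (s - p)"
      by (intro always_eventually allI) (simp add: barnes_kernel_def p_def field_simps)
  qed
  thus "((\<lambda>w. barnes_kernel \<nu> L w * (w - (\<nu> - 2 * of_nat l))) \<longlongrightarrow>
      (- 1) ^ l / fact l * Gamma (\<nu> - of_nat l) * exp (- ((\<nu> - 2 * of_nat l) * L)) / 2) (at (\<nu> - 2 * of_nat l))"
    unfolding half by (simp add: p_def mult.assoc)
qed

definition barnes_residue_sum :: "nat \<Rightarrow> nat \<Rightarrow> complex \<Rightarrow> complex \<Rightarrow> complex" where
  "barnes_residue_sum N1 N2 \<nu> L = (\<Sum>l<N1. residue (barnes_kernel \<nu> L) (\<nu> - 2 * of_nat l)) +
     (\<Sum>l<N2. residue (barnes_kernel \<nu> L) (- \<nu> - 2 * of_nat l))"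

text \<open>
  The residue theorem on a rectangle with vertical sides at \<open>c\<close> and \<open>d\<close>. The numbers \<open>N1\<close> and \<open>N2\<close>
  count the poles of each family to the right of \<open>d\<close>; the horizontal sides are moved
  into the error term.
\<close>
lemma barnes_kernel_rectangle:
  fixes N1 N2 :: nat
  assumes \<nu>: "\<nu> \<notin> \<int>" and T: "T > \<bar>Im \<nu>\<bar>" and dc: "d < c" and c: "c > \<bar>Re \<nu>\<bar>"
    and N1: "\<And>l. l < N1 \<longleftrightarrow> d < Re \<nu> - 2 * real l" "d \<noteq> Re \<nu> - 2 * real N1"
    and N2: "\<And>l. l < N2 \<longleftrightarrow> d < - Re \<nu> - 2 * real l" "d \<noteq> - Re \<nu> - 2 * real N2"
    and bound: "\<And>\<sigma> t. \<sigma> \<in> {d..c} \<Longrightarrow> \<bar>t\<bar> = T \<Longrightarrow> norm (barnes_kernel \<nu> L (Complex \<sigma> t)) \<le> B"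
  shows "norm (integral {-T..T} (\<lambda>t. barnes_kernel \<nu> L (Complex c t)) -
      integral {-T..T} (\<lambda>t. barnes_kernel \<nu> L (Complex d t)) - 2 * pi * barnes_residue_sum N1 N2 \<nu> L) \<le> 2 * (c - d) * B"
proof -
  define k where "k = barnes_kernel \<nu> L"
  define P1 where "P1 = (\<lambda>l. \<nu> - 2 * of_nat l) ` {..<N1}"
  define P2 where "P2 = (\<lambda>l. - \<nu> - 2 * of_nat l) ` {..<N2}"
  \<comment> \<open>The boundary of this half plane passes through the first pole to the left of the rectangle.\<close>
  define S where "S = {s. Re s > max (Re \<nu> - 2 * real N1) (- Re \<nu> - 2 * real N2)}"
  define a1 a2 a3 a4 where a_def: "a1 = Complex d (-T)" "a2 = Complex c (-T)" "a3 = Complex c T" "a4 = Complex d T"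
  have T0: "T > 0" using T by linarith
  have N1': "Re \<nu> - 2 * real N1 < d" using N1(1)[of N1] N1(2) by auto
  have N2': "- Re \<nu> - 2 * real N2 < d" using N2(1)[of N2] N2(2) by auto
  have S_conv: "convex S" and S_open: "open S"
    unfolding S_def by (rule convex_halfspace_Re_gt open_halfspace_Re_gt)+
  have holo: "k holomorphic_on S - (P1 \<union> P2)"
    unfolding k_def
  proof (rule barnes_kernel_holomorphic)
    fix s l assume s: "s \<in> S - (P1 \<union> P2)"
    show "s \<noteq> \<nu> - 2 * of_nat l"
    proof
      assume eq: "s = \<nu> - 2 * of_nat l"
      hence "l < N1" using s by (auto simp: S_def)
      thus False using s eq by (auto simp: P1_def)
    qed
    show "s \<noteq> - \<nu> - 2 * of_nat l"
    proof
      assume eq: "s = - \<nu> - 2 * of_nat l"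
      hence "l < N2" using s by (auto simp: S_def)
      thus False using s eq by (auto simp: P2_def)
    qed
  qed
  have inside: "p \<in> box a1 a3" if "p \<in> P1 \<union> P2" for p
  proof -
    from that consider l where "l < N1" "p = \<nu> - 2 * of_nat l" | l where "l < N2" "p = - \<nu> - 2 * of_nat l"
      by (auto simp: P1_def P2_def)
    hence "d < Re p \<and> Re p \<le> \<bar>Re \<nu>\<bar> \<and> \<bar>Im p\<bar> = \<bar>Im \<nu>\<bar>"
      by cases (use N1(1) N2(1) in \<open>simp_all add: abs_if\<close>)
    hence "d < Re p" "Re p < c" "\<bar>Im p\<bar> < T" using T c by linarith+
    thus ?thesis by (simp add: a_def in_box_complex_iff abs_less_iff)
  qed
  have le: "Re a1 \<le> Re a3" "Im a1 \<le> Im a3" using dc T0 by (auto simp: a_def)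
  have img: "path_image (rectpath a1 a3) \<subseteq> S - (P1 \<union> P2)"
  proof -
    have "cbox a1 a3 \<subseteq> S" using N1' N2' by (auto simp: S_def a_def in_cbox_complex_iff)
    thus ?thesis using inside path_image_rectpath_cbox_minus_box[OF le] by blast
  qed
  have "contour_integral (rectpath a1 a3) k =
     2 * pi * \<i> * (\<Sum>p\<in>P1 \<union> P2. winding_number (rectpath a1 a3) p * residue k p)"
  proof (rule Residue_theorem[OF S_open convex_connected[OF S_conv] _ holo])
    show "\<forall>z. z \<notin> S \<longrightarrow> winding_number (rectpath a1 a3) z = 0"
      using img by (intro allI impI winding_number_zero_outside[OF _ S_conv]) auto
  qed (use img in \<open>auto simp: P1_def P2_def\<close>)
  also have "(\<Sum>p\<in>P1 \<union> P2. winding_number (rectpath a1 a3) p * residue k p) = (\<Sum>p\<in>P1 \<union> P2. residue k p)"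
    using winding_number_rectpath[OF inside] by (intro sum.cong) auto
  also have "\<dots> = (\<Sum>p\<in>P1. residue k p) + (\<Sum>p\<in>P2. residue k p)"
  proof (rule sum.union_disjoint)
    have "\<nu> - 2 * of_nat l \<noteq> - \<nu> - 2 * of_nat m" for l m
    proof
      assume "\<nu> - 2 * of_nat l = - \<nu> - 2 * of_nat m"
      hence "2 * \<nu> = 2 * (of_nat l - of_nat m)" by (simp add: algebra_simps)
      hence "\<nu> = of_nat l - of_nat m" by (metis mult_left_cancel zero_neq_numeral)
      thus False using \<nu> by simp
    qed
    thus "P1 \<inter> P2 = {}" by (auto simp: P1_def P2_def)
  qed (auto simp: P1_def P2_def)
  also have "(\<Sum>p\<in>P1. residue k p) = (\<Sum>l<N1. residue k (\<nu> - 2 * of_nat l))"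
    unfolding P1_def by (subst sum.reindex) (auto simp: inj_on_def)
  also have "(\<Sum>p\<in>P2. residue k p) = (\<Sum>l<N2. residue k (- \<nu> - 2 * of_nat l))"
    unfolding P2_def by (subst sum.reindex) (auto simp: inj_on_def)
  finally have res: "contour_integral (rectpath a1 a3) k = 2 * pi * \<i> * barnes_residue_sum N1 N2 \<nu> L"
    by (simp add: barnes_residue_sum_def k_def)
  have rect: "rectpath a1 a3 = linepath a1 a2 +++ linepath a2 a3 +++ linepath a3 a4 +++ linepath a4 a1"
    by (simp add: rectpath_def Let_def a_def)
  have "path_image (rectpath a1 a3) = closed_segment a1 a2 \<union> closed_segment a2 a3 \<union> closed_segment a3 a4 \<union> closed_segment a4 a1"
    unfolding rect by (simp add: path_image_join Un_assoc)
  hence "continuous_on (closed_segment a1 a2 \<union> closed_segment a2 a3 \<union> closed_segment a3 a4 \<union> closed_segment a4 a1) k"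
    using img by (metis holo holomorphic_on_imp_continuous_on continuous_on_subset)
  hence ci: "k contour_integrable_on linepath a1 a2" "k contour_integrable_on linepath a2 a3"
    "k contour_integrable_on linepath a3 a4" "k contour_integrable_on linepath a4 a1"
    by (auto intro!: contour_integrable_continuous_linepath elim: continuous_on_subset)
  define h1 where "h1 = contour_integral (linepath a1 a2) k"
  define h2 where "h2 = contour_integral (linepath a3 a4) k"
  have v1: "contour_integral (linepath a2 a3) k = \<i> * integral {-T..T} (\<lambda>t. k (Complex c t))"
    using T0 by (intro contour_integral_linepath_same_Re) (auto simp: a_def)
  have "contour_integral (linepath a1 a4) k = \<i> * integral {-T..T} (\<lambda>t. k (Complex d t))"
    using T0 by (intro contour_integral_linepath_same_Re) (auto simp: a_def)
  hence v2: "contour_integral (linepath a4 a1) k = - (\<i> * integral {-T..T} (\<lambda>t. k (Complex d t)))"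
    using ci(4) by (metis contour_integral_reverse_linepath continuous_on_subset
      \<open>continuous_on (closed_segment a1 a2 \<union> closed_segment a2 a3 \<union> closed_segment a3 a4 \<union> closed_segment a4 a1) k\<close>
      Un_upper2)
  have "contour_integral (rectpath a1 a3) k = h1 + (\<i> * integral {-T..T} (\<lambda>t. k (Complex c t)) +
     (h2 + - (\<i> * integral {-T..T} (\<lambda>t. k (Complex d t)))))"
    unfolding rect using ci by (simp add: contour_integrable_joinI v1 v2 h1_def h2_def)
  hence "\<i> * (integral {-T..T} (\<lambda>t. k (Complex c t)) -
      integral {-T..T} (\<lambda>t. k (Complex d t)) - 2 * pi * barnes_residue_sum N1 N2 \<nu> L) = - (h1 + h2)"
    using res by (simp add: algebra_simps)
  hence "norm (integral {-T..T} (\<lambda>t. k (Complex c t)) -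
      integral {-T..T} (\<lambda>t. k (Complex d t)) - 2 * pi * barnes_residue_sum N1 N2 \<nu> L) = norm (h1 + h2)"
    by (metis mult_1 norm_ii norm_minus_cancel norm_mult)
  also have "\<dots> \<le> norm h1 + norm h2" by (rule norm_triangle_ineq)
  also have "\<dots> \<le> B * (c - d) + B * (c - d)"
  proof -
    have "norm (barnes_kernel \<nu> L (Complex c T)) \<le> B" using bound[of c T] dc T0 by simp
    hence B: "B \<ge> 0" by (rule order_trans[OF norm_ge_zero])
    have seg: "norm (k z) \<le> B" if "z \<in> closed_segment a1 a2 \<union> closed_segment a3 a4" for z
    proof -
      have "Re z \<in> {d..c}" "\<bar>Im z\<bar> = T"
        using that dc T0 by (auto simp: a_def closed_segment_same_Im closed_segment_eq_real_ivl)
      thus ?thesis using bound[of "Re z" "Im z"] by (simp add: k_def)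
    qed
    have len: "norm (a2 - a1) = c - d" "norm (a4 - a3) = c - d" using dc by (auto simp: a_def cmod_def)
    have "norm h1 \<le> B * norm (a2 - a1)" unfolding h1_def
      by (rule contour_integral_bound_linepath[OF ci(1) B]) (use seg in auto)
    moreover have "norm h2 \<le> B * norm (a4 - a3)" unfolding h2_def
      by (rule contour_integral_bound_linepath[OF ci(3) B]) (use seg in auto)
    ultimately show ?thesis using len by simp
  qed
  finally show ?thesis by (simp add: k_def algebra_simps)
qed

text \<open>
  The height of the rectangle tends to infinity.
\<close>
lemma barnes_kernel_shift:
  fixes N1 N2 :: nat
  assumes \<nu>: "\<nu> \<notin> \<int>" and L: "\<bar>Im L\<bar> < pi / 4" and dc: "d < c" and c: "c > \<bar>Re \<nu>\<bar>"
    and N1: "\<And>l. l < N1 \<longleftrightarrow> d < Re \<nu> - 2 * real l" "\<And>l. d \<noteq> Re \<nu> - 2 * real l"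
    and N2: "\<And>l. l < N2 \<longleftrightarrow> d < - Re \<nu> - 2 * real l" "\<And>l. d \<noteq> - Re \<nu> - 2 * real l"
  shows "(LINT t|lborel. barnes_kernel \<nu> L (Complex c t)) - (LINT t|lborel. barnes_kernel \<nu> L (Complex d t)) =
     2 * pi * barnes_residue_sum N1 N2 \<nu> L"
proof -
  define R where "R = 2 * pi * barnes_residue_sum N1 N2 \<nu> L"
  define Ic where "Ic = (\<lambda>c. LINT t|lborel. barnes_kernel \<nu> L (Complex c t))"
  define J where "J = (\<lambda>c T. integral {-T..T} (\<lambda>t. barnes_kernel \<nu> L (Complex c t)))"
  obtain C where C: "C \<ge> 0" "\<And>\<sigma> t. \<sigma> \<in> {d..c} \<Longrightarrow> \<bar>t\<bar> \<ge> \<bar>Im \<nu>\<bar> + 2 \<Longrightarrow>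
      norm (barnes_kernel \<nu> L (Complex \<sigma> t)) \<le> C * exp (- ((pi / 4 - \<bar>Im L\<bar>) * \<bar>t\<bar>))"
    using barnes_kernel_strip_bound[of d c \<nu> L] by metis
  have "(J c \<longlongrightarrow> Ic c) at_top"
    unfolding J_def Ic_def using c L
    by (intro integral_symmetric_interval_tendsto integrable_barnes_kernel) (auto elim!: nonpos_Ints_cases)
  moreover have "(J d \<longlongrightarrow> Ic d) at_top"
    unfolding J_def Ic_def
  proof (intro integral_symmetric_interval_tendsto integrable_barnes_kernel L)
    show "(d - Re \<nu>) / 2 \<notin> \<int>\<^sub>\<le>\<^sub>0"
    proof
      assume "(d - Re \<nu>) / 2 \<in> \<int>\<^sub>\<le>\<^sub>0"
      then obtain l where "(d - Re \<nu>) / 2 = - of_nat l" by (auto elim!: nonpos_Ints_cases')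
      hence "d = Re \<nu> - 2 * real l" by simp
      thus False using N1(2) by blast
    qed
    show "(d + Re \<nu>) / 2 \<notin> \<int>\<^sub>\<le>\<^sub>0"
    proof
      assume "(d + Re \<nu>) / 2 \<in> \<int>\<^sub>\<le>\<^sub>0"
      then obtain l where "(d + Re \<nu>) / 2 = - of_nat l" by (auto elim!: nonpos_Ints_cases')
      hence "d = - Re \<nu> - 2 * real l" by simp
      thus False using N2(2) by blast
    qed
  qed
  ultimately have lim: "((\<lambda>T. norm (J c T - J d T - R)) \<longlongrightarrow> norm (Ic c - Ic d - R)) at_top"
    by (intro tendsto_intros)
  have "((\<lambda>T. 2 * (c - d) * (C * exp (- ((pi / 4 - \<bar>Im L\<bar>) * T)))) \<longlongrightarrow> 2 * (c - d) * (C * 0)) at_top"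
  proof (intro tendsto_intros)
    have "filterlim (\<lambda>T. (pi / 4 - \<bar>Im L\<bar>) * T) at_top at_top"
      using L by (intro filterlim_tendsto_pos_mult_at_top[OF tendsto_const] filterlim_ident) auto
    thus "((\<lambda>T. exp (- ((pi / 4 - \<bar>Im L\<bar>) * T))) \<longlongrightarrow> 0) at_top"
      by (intro filterlim_compose[OF exp_at_bot] filterlim_compose[OF filterlim_uminus_at_bot_at_top])
  qed
  moreover have "\<forall>\<^sub>F T in at_top. norm (J c T - J d T - R) \<le> 2 * (c - d) * (C * exp (- ((pi / 4 - \<bar>Im L\<bar>) * T)))"
    using eventually_ge_at_top[of "\<bar>Im \<nu>\<bar> + 2"]
  proof eventually_elim
    case (elim T)
    show ?case unfolding J_def R_def
    proof (rule barnes_kernel_rectangle[OF \<nu> _ dc c N1(1) N1(2) N2(1) N2(2)])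
      show "T > \<bar>Im \<nu>\<bar>" using elim by simp
      fix \<sigma> t assume "\<sigma> \<in> {d..c}" "\<bar>t\<bar> = T"
      thus "norm (barnes_kernel \<nu> L (Complex \<sigma> t)) \<le> C * exp (- ((pi / 4 - \<bar>Im L\<bar>) * T))"
        using C(2)[of \<sigma> t] elim by auto
    qed
  qed
  ultimately have "norm (Ic c - Ic d - R) \<le> 2 * (c - d) * (C * 0)"
    using lim by (intro tendsto_le[OF trivial_limit_at_top_linorder]) auto
  hence "Ic c - Ic d - R = 0" by simp
  thus ?thesis by (simp add: Ic_def R_def)
qed

section \<open>The Mellin-Barnes integral of K\<close>

text \<open>
  Going one step to the left divides \<open>Gamma\<close> by a factor of modulus about \<open>k\<close>, which eventually beats
  any geometric growth.
\<close>
lemma geometric_times_Gamma_left_tendsto_0: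
  fixes \<delta> q :: real
  assumes \<delta>: "\<delta> \<notin> \<int>" and q: "q \<ge> 0"
  shows "(\<lambda>k. q ^ k * \<bar>Gamma (\<delta> - real k)\<bar>) \<longlonglongrightarrow> 0"
proof (rule summable_LIMSEQ_zero, rule summable_ratio_test)
  define N where "N = nat \<lceil>\<bar>\<delta>\<bar> + 2 * q\<rceil>"
  show "(1 / 2 :: real) < 1" by simp
  fix n assume "n \<ge> N"
  hence n: "real n \<ge> \<bar>\<delta>\<bar> + 2 * q" unfolding N_def by linarith
  define u where "u = \<delta> - real (Suc n)"
  have "u \<notin> \<int>"
    using \<delta> Ints_add[of u "real (Suc n)"] by (auto simp: u_def)
  hence "u \<notin> \<int>\<^sub>\<le>\<^sub>0" using nonpos_Ints_subset_Ints by blast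
  hence "Gamma (u + 1) = u * Gamma u" by (rule Gamma_plus1)
  moreover have "u + 1 = \<delta> - real n" by (simp add: u_def)
  ultimately have G: "\<bar>Gamma (\<delta> - real n)\<bar> = \<bar>u\<bar> * \<bar>Gamma u\<bar>" by (simp add: abs_mult)
  have "2 * q \<le> \<bar>u\<bar>" using n q by (auto simp: u_def)
  hence "q ^ n * (2 * q * \<bar>Gamma u\<bar>) \<le> q ^ n * (\<bar>u\<bar> * \<bar>Gamma u\<bar>)"
    using q by (intro mult_left_mono mult_right_mono) auto
  hence "q ^ Suc n * \<bar>Gamma u\<bar> \<le> 1 / 2 * (q ^ n * \<bar>Gamma (\<delta> - real n)\<bar>)"
    unfolding G by (simp add: mult_ac)
  thus "norm (q ^ Suc n * \<bar>Gamma (\<delta> - real (Suc n))\<bar>) \<le> 1 / 2 * norm (q ^ n * \<bar>Gamma (\<delta> - real n)\<bar>)"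
    using q unfolding u_def by (simp add: abs_mult)
qed

text \<open>
  The ratio of consecutive terms is \<open>y / ((m + 1) (\<nu> + m + 1))\<close>. The argument uses the functional
  equation of the entire function \<open>rGamma\<close>, so it also covers the negative integers \<open>\<nu>\<close>,
  where an initial segment of the series vanishes.
\<close>
lemma summable_bessel_series:
  fixes y \<nu> :: complex
  shows "summable (\<lambda>m. norm (y ^ m * rGamma (\<nu> + of_nat m + 1) / fact m))"
proof (rule summable_ratio_test)
  define N where "N = nat \<lceil>norm \<nu> + 2 * norm y\<rceil>"
  show "(1 / 2 :: real) < 1" by simp
  fix m assume "m \<ge> N"
  hence m: "real m \<ge> norm \<nu> + 2 * norm y" unfolding N_def by linarith
  define u where "u = \<nu> + of_nat m + 1"
  have "norm (of_nat (Suc m) :: complex) \<le> norm u + norm \<nu>"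
    using norm_triangle_ineq4[of u \<nu>] by (simp add: u_def algebra_simps)
  hence u1: "norm u \<ge> 1" using m norm_ge_zero[of y] by (simp only: norm_of_nat)
  have "2 * norm y \<le> real (Suc m)"
    using m norm_ge_zero[of \<nu>] unfolding of_nat_Suc by linarith
  hence "2 * norm y * 1 \<le> real (Suc m) * norm u"
    using u1 by (intro mult_mono) auto
  hence y: "norm y / real (Suc m) \<le> 1 / 2 * norm u" by (simp add: field_simps)
  have "norm (y ^ Suc m * rGamma (\<nu> + of_nat (Suc m) + 1) / fact (Suc m)) =
     norm y ^ m * norm (rGamma (u + 1)) / fact m * (norm y / real (Suc m))"
  proof -
    have "\<nu> + of_nat (Suc m) + 1 = u + 1" by (simp add: u_def)
    thus ?thesis by (simp add: norm_mult norm_divide norm_power mult_ac del: of_nat_Suc)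
  qed
  also have "\<dots> \<le> norm y ^ m * norm (rGamma (u + 1)) / fact m * (1 / 2 * norm u)"
    by (intro mult_left_mono y) auto
  also have "\<dots> = 1 / 2 * (norm y ^ m * norm (u * rGamma (u + 1)) / fact m)"
    by (simp add: norm_mult mult_ac)
  also have "\<dots> = 1 / 2 * norm (norm (y ^ m * rGamma (\<nu> + of_nat m + 1) / fact m))"
    unfolding rGamma_plus1 by (simp add: norm_mult norm_divide norm_power u_def)
  finally show "norm (norm (y ^ Suc m * rGamma (\<nu> + of_nat (Suc m) + 1) / fact (Suc m)))
      \<le> 1 / 2 * norm (norm (y ^ m * rGamma (\<nu> + of_nat m + 1) / fact m))" by simp
qed

lemma sin_pi_minus_nat:
  "sin (of_real pi * (\<nu> - of_nat l)) = (- 1) ^ l * sin (\<nu> * of_real pi :: complex)"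
proof -
  have "sin (of_real pi * of_nat l :: complex) = of_real (sin (pi * real l))"
    by (metis of_real_mult of_real_of_nat_eq sin_of_real)
  moreover have "cos (of_real pi * of_nat l :: complex) = of_real (cos (pi * real l))"
    by (metis of_real_mult of_real_of_nat_eq cos_of_real)
  ultimately show ?thesis
    by (simp add: right_diff_distrib sin_diff mult.commute)
qed

definition bessel_I_term :: "complex \<Rightarrow> complex \<Rightarrow> nat \<Rightarrow> complex" where
  "bessel_I_term \<nu> y l = (y / 2) ^ (2 * l) * rGamma (\<nu> + of_nat l + 1) / fact l"

lemma summable_bessel_I_term: "summable (bessel_I_term \<nu> y)"
  using summable_norm_cancel[OF summable_bessel_series[of "(y / 2) ^ 2" \<nu>]]
  by (simp add: bessel_I_term_def[abs_def] power_mult)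

lemma bessel_I_eq:
  "y \<noteq> 0 \<Longrightarrow> bessel_I \<nu> y = exp (\<nu> * Ln (y / 2)) * (\<Sum>l. bessel_I_term \<nu> y l)"
  by (simp add: bessel_I_def bessel_I_term_def principal_pow_def powr_def)

text \<open>
  The reflection formula turns \<open>Gamma (\<nu> - l)\<close> into a reciprocal Gamma value, and the
  residues become the terms of the series of \<open>I\<^bsub>- \<nu>\<^esub>\<close>, up to a factor independent of \<open>l\<close>.
\<close>
lemma barnes_kernel_residue_bessel:
  assumes \<nu>: "\<nu> \<notin> \<int>" and X: "X \<noteq> 0"
  shows "residue (barnes_kernel \<nu> (Ln (X / 2))) (\<nu> - 2 * of_nat l) =
    of_real pi / (2 * sin (\<nu> * of_real pi)) * exp (- \<nu> * Ln (X / 2)) * bessel_I_term (- \<nu>) X l"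
proof -
  define z where "z = \<nu> - of_nat l"
  have "z \<notin> \<int>" using \<nu> Ints_add[of z "of_nat l"] by (auto simp: z_def)
  hence z: "1 - z \<notin> \<int>\<^sub>\<le>\<^sub>0"
    using Ints_diff[of 1 "1 - z"] nonpos_Ints_subset_Ints by auto
  have "Gamma z * Gamma (1 - z) = of_real pi / ((- 1) ^ l * sin (\<nu> * of_real pi))"
    unfolding Gamma_reflection_complex z_def sin_pi_minus_nat ..
  hence "Gamma z * Gamma (1 - z) * rGamma (1 - z) = of_real pi / ((- 1) ^ l * sin (\<nu> * of_real pi)) * rGamma (1 - z)"
    by simp
  moreover have "Gamma (1 - z) * rGamma (1 - z) = 1"
    using z by (simp add: rGamma_inverse_Gamma Gamma_eq_zero_iff)
  ultimately have G: "Gamma z = of_real pi / ((- 1) ^ l * sin (\<nu> * of_real pi)) * rGamma (1 - z)"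
    by (simp add: mult.assoc)
  have "exp (- ((\<nu> - 2 * of_nat l) * Ln (X / 2))) = exp (- \<nu> * Ln (X / 2) + of_nat (2 * l) * Ln (X / 2))"
    by (simp add: algebra_simps)
  also have "\<dots> = exp (- \<nu> * Ln (X / 2)) * (X / 2) ^ (2 * l)"
    using X by (simp only: exp_add exp_of_nat_mult) simp
  finally have E: "exp (- ((\<nu> - 2 * of_nat l) * Ln (X / 2))) = exp (- \<nu> * Ln (X / 2)) * (X / 2) ^ (2 * l)" .
  have "residue (barnes_kernel \<nu> (Ln (X / 2))) (\<nu> - 2 * of_nat l) =
     (- 1) ^ l / fact l * (of_real pi / ((- 1) ^ l * sin (\<nu> * of_real pi)) * rGamma (1 - z)) *
       (exp (- \<nu> * Ln (X / 2)) * (X / 2) ^ (2 * l)) / 2"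
    by (simp only: barnes_kernel_residue[OF \<nu>] E z_def[symmetric] G)
  also have "\<dots> = of_real pi / (2 * sin (\<nu> * of_real pi)) * exp (- \<nu> * Ln (X / 2)) *
      ((X / 2) ^ (2 * l) * rGamma (1 - z) / fact l)"
  proof -
    have *: "s / f * (p / (s * q) * R) * (e * Y) / 2 = p / (2 * q) * e * (Y * R / f)"
      if "s \<noteq> 0" for s f p q R e Y :: complex
      using that by (simp add: mult_ac)
    show ?thesis by (rule *) simp
  qed
  also have "1 - z = - \<nu> + of_nat l + 1" by (simp add: z_def)
  finally show ?thesis unfolding bessel_I_term_def .
qed

text \<open>
  The line of integration is moved to the left over all poles. The residues add up to the series of
  \<open>I\<^bsub>- \<nu>\<^esub>\<close> and \<open>I\<^sub>\<nu>\<close>, and the remaining integrals tend to 0 because on the line with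
  abscissa \<open>d k\<close> the kernel is of the order \<open>q\<^bsup>2 k\<^esup> Gamma (- x1 - k) Gamma (- x2 - k)\<close>.
\<close>
lemma barnes_integral_nonint:
  assumes \<nu>: "\<nu> \<notin> \<int>" and X: "X \<noteq> 0" and L: "\<bar>Im (Ln (X / 2))\<bar> < pi / 4" and c: "c > \<bar>Re \<nu>\<bar>"
  shows "(LINT t|lborel. barnes_kernel \<nu> (Ln (X / 2)) (Complex c t)) = 2 * pi * bessel_K_nonint \<nu> X"
proof -
  define L where "L = Ln (X / 2)"
  define r where "r = Re \<nu>"
  \<comment> \<open>One of \<open>1/2\<close> and \<open>1/3\<close> works, since \<open>\<bar>r\<bar> + 1/2\<close> and \<open>\<bar>r\<bar> + 1/3\<close> differ by \<open>1/6\<close>.\<close>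
  obtain e :: real where e: "e > 0" "\<bar>r\<bar> + e \<notin> \<int>" "e \<notin> \<int>"
  proof (cases "\<bar>r\<bar> + 1 / 2 \<in> \<int>")
    case True
    have n: "1 / 2 \<notin> (\<int> :: real set)" "1 / 3 \<notin> (\<int> :: real set)" "1 / 6 \<notin> (\<int> :: real set)"
      using fraction_not_in_Ints[of 2 1, where 'a = real] fraction_not_in_Ints[of 3 1, where 'a = real]
        fraction_not_in_Ints[of 6 1, where 'a = real] by simp_all
    have "\<bar>r\<bar> + 1 / 3 \<notin> \<int>"
      using Ints_diff[OF True, of "\<bar>r\<bar> + 1 / 3"] n by auto
    thus ?thesis using n that[of "1 / 3"] by auto
  next
    case False
    thus ?thesis using that[of "1 / 2"] fraction_not_in_Ints[of 2 1, where 'a = real] by auto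
  qed
  define x1 x2 where "x1 = (\<bar>r\<bar> + r) / 2 + e" and "x2 = (\<bar>r\<bar> - r) / 2 + e"
  have x: "x1 > 0" "x2 > 0" "x1 \<notin> \<int>" "x2 \<notin> \<int>"
    using e by (auto simp: x1_def x2_def abs_if split: if_splits)
  \<comment> \<open>Abscissae between the poles of both families; moving by 2 crosses exactly one pole of each.\<close>
  define d where "d = (\<lambda>k::nat. - \<bar>r\<bar> - 2 * e - 2 * real k)"
  have dx: "(d k - r) / 2 = - x1 - real k" "(d k + r) / 2 = - x2 - real k" for k
    by (simp_all add: d_def x1_def x2_def field_simps)
  have not_int: "- y - real k \<notin> \<int>" if "y \<notin> \<int>" for y k
    using Ints_add[of "- y - real k" "real k"] Ints_minus[of "-y"] that by auto
  have not_nonpos: "(d k - r) / 2 \<notin> \<int>\<^sub>\<le>\<^sub>0" "(d k + r) / 2 \<notin> \<int>\<^sub>\<le>\<^sub>0" for k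
    unfolding dx using not_int x nonpos_Ints_subset_Ints by blast+
  define N1 N2 where "N1 = nat \<lceil>x1\<rceil>" and "N2 = nat \<lceil>x2\<rceil>"
  have N: "l < nat \<lceil>y\<rceil> + k \<longleftrightarrow> real l < y + real k" if "y > 0" for l k y
  proof -
    have "l < nat \<lceil>y\<rceil> + k \<longleftrightarrow> int l - int k < \<lceil>y\<rceil>" using that by linarith
    also have "\<dots> \<longleftrightarrow> real l < y + real k" by (subst less_ceiling_iff) auto
    finally show ?thesis .
  qed
  define E where "E = (LINT t|lborel. exp (- ((pi / 4 - \<bar>Im L\<bar>) * \<bar>t\<bar>)))"
  define Id where "Id = (\<lambda>k. LINT t|lborel. barnes_kernel \<nu> L (Complex (d k) t))"
  define Ic where "Ic = (LINT t|lborel. barnes_kernel \<nu> L (Complex c t))"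
  have shift: "Ic - Id k = 2 * pi * barnes_residue_sum (N1 + k) (N2 + k) \<nu> L" for k
    unfolding Ic_def Id_def
  proof (rule barnes_kernel_shift[OF \<nu> _ _ c])
    show "\<bar>Im L\<bar> < pi / 4" using L by (simp add: L_def)
    show "d k < c" using c e by (simp add: d_def)
    show "l < N1 + k \<longleftrightarrow> d k < Re \<nu> - 2 * real l" for l
    proof -
      have "real l < x1 + real k \<longleftrightarrow> d k < Re \<nu> - 2 * real l"
        by (auto simp: d_def x1_def r_def field_simps)
      thus ?thesis using N[OF x(1)] by (simp add: N1_def)
    qed
    show "l < N2 + k \<longleftrightarrow> d k < - Re \<nu> - 2 * real l" for l
    proof -
      have "real l < x2 + real k \<longleftrightarrow> d k < - Re \<nu> - 2 * real l"
        by (auto simp: d_def x2_def r_def field_simps)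
      thus ?thesis using N[OF x(2)] by (simp add: N2_def)
    qed
    show "d k \<noteq> Re \<nu> - 2 * real l" for l
    proof
      assume "d k = Re \<nu> - 2 * real l"
      hence "(d k - r) / 2 = - real l" by (simp add: r_def)
      thus False using not_nonpos(1)[of k] by simp
    qed
    show "d k \<noteq> - Re \<nu> - 2 * real l" for l
    proof
      assume "d k = - Re \<nu> - 2 * real l"
      hence "(d k + r) / 2 = - real l" by (simp add: r_def)
      thus False using not_nonpos(2)[of k] by simp
    qed
  qed
  have Id_lim: "Id \<longlonglongrightarrow> 0"
  proof (rule Lim_null_comparison)
    \<comment> \<open>\<open>q\<^sup>2\<close> collects the growth per step of \<open>2 powr (\<bar>d k\<bar> / 2)\<close> and of \<open>exp (- d k * Re L)\<close>.\<close>
    define q where "q = sqrt 2 * exp (Re L)"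
    define C where "C = 2 powr (\<bar>r\<bar> + e + 1) * exp ((\<bar>r\<bar> + 2 * e) * Re L) * E"
    show "\<forall>\<^sub>F k in sequentially. norm (Id k) \<le>
       C * ((q ^ k * \<bar>Gamma (- x1 - real k)\<bar>) * (q ^ k * \<bar>Gamma (- x2 - real k)\<bar>))"
    proof (intro always_eventually allI)
      fix k
      have "norm (Id k) \<le> \<bar>Gamma ((d k - r) / 2)\<bar> * \<bar>Gamma ((d k + r) / 2)\<bar> *
          2 powr ((\<bar>d k\<bar> + \<bar>r\<bar>) / 2 + 1) * exp (- (d k * Re L)) * E"
        unfolding Id_def E_def r_def
        by (rule integrable_barnes_kernel(2)) (use not_nonpos L in \<open>auto simp: r_def L_def\<close>)
      also have "2 powr ((\<bar>d k\<bar> + \<bar>r\<bar>) / 2 + 1) = 2 powr (\<bar>r\<bar> + e + 1) * 2 ^ k"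
      proof -
        have "(\<bar>d k\<bar> + \<bar>r\<bar>) / 2 + 1 = (\<bar>r\<bar> + e + 1) + real k"
          using e by (simp add: d_def abs_if[of "_ - _"])
        thus ?thesis by (simp only: powr_add) (simp add: powr_realpow)
      qed
      also have "exp (- (d k * Re L)) = exp ((\<bar>r\<bar> + 2 * e) * Re L) * (exp (Re L) ^ k * exp (Re L) ^ k)"
      proof -
        have "- (d k * Re L) = (\<bar>r\<bar> + 2 * e) * Re L + (real k * Re L + real k * Re L)"
          by (simp add: d_def algebra_simps)
        thus ?thesis by (simp only: exp_add exp_of_nat_mult)
      qed
      finally have "norm (Id k) \<le> C * ((2 ^ k * exp (Re L) ^ k * exp (Re L) ^ k) * (\<bar>Gamma ((d k - r) / 2)\<bar> * \<bar>Gamma ((d k + r) / 2)\<bar>))"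
        by (simp add: C_def mult_ac)
      also have "2 ^ k * exp (Re L) ^ k * exp (Re L) ^ k = q ^ k * q ^ k"
      proof -
        have "sqrt 2 ^ k * sqrt 2 ^ k = (2 :: real) ^ k"
          by (simp flip: power_mult_distrib)
        thus ?thesis by (simp add: q_def power_mult_distrib mult_ac)
      qed
      finally show "norm (Id k) \<le> C * ((q ^ k * \<bar>Gamma (- x1 - real k)\<bar>) * (q ^ k * \<bar>Gamma (- x2 - real k)\<bar>))"
        unfolding dx by (simp only: mult_ac)
    qed
    have "- x1 \<notin> \<int>" "- x2 \<notin> \<int>" "q \<ge> 0" using x by (auto simp: q_def)
    hence "(\<lambda>k. C * ((q ^ k * \<bar>Gamma (- x1 - real k)\<bar>) * (q ^ k * \<bar>Gamma (- x2 - real k)\<bar>))) \<longlonglongrightarrow> C * (0 * 0)"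
      by (intro tendsto_intros geometric_times_Gamma_left_tendsto_0)
    thus "(\<lambda>k. C * ((q ^ k * \<bar>Gamma (- x1 - real k)\<bar>) * (q ^ k * \<bar>Gamma (- x2 - real k)\<bar>))) \<longlonglongrightarrow> 0"
      by simp
  qed
  define A where "A = of_real pi / (2 * sin (\<nu> * of_real pi))"
  have rs: "barnes_residue_sum n m \<nu> L =
     A * exp (- \<nu> * L) * (\<Sum>l<n. bessel_I_term (- \<nu>) X l) - A * exp (\<nu> * L) * (\<Sum>l<m. bessel_I_term \<nu> X l)" for n m
  proof -
    have "residue (barnes_kernel \<nu> L) (- \<nu> - 2 * of_nat l) = - (A * exp (\<nu> * L) * bessel_I_term \<nu> X l)" for l
      using barnes_kernel_residue_bessel[of "-\<nu>" X l] \<nu> X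
      by (simp add: A_def L_def barnes_kernel_uminus)
    moreover have "residue (barnes_kernel \<nu> L) (\<nu> - 2 * of_nat l) = A * exp (- \<nu> * L) * bessel_I_term (- \<nu>) X l" for l
      using barnes_kernel_residue_bessel[of \<nu> X l] \<nu> X by (simp add: A_def L_def)
    ultimately show ?thesis
      unfolding barnes_residue_sum_def by (simp add: sum_distrib_left sum_negf)
  qed
  have part: "(\<lambda>k. \<Sum>l<n+k. bessel_I_term \<mu> X l) \<longlonglongrightarrow> (\<Sum>l. bessel_I_term \<mu> X l)" for \<mu> n
    using LIMSEQ_ignore_initial_segment[OF summable_LIMSEQ[OF summable_bessel_I_term[of \<mu> X]], of n]
    by (simp add: add.commute)
  have "(\<lambda>k. Id k + 2 * pi * barnes_residue_sum (N1 + k) (N2 + k) \<nu> L) \<longlonglongrightarrow>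
      0 + 2 * pi * (A * exp (- \<nu> * L) * (\<Sum>l. bessel_I_term (- \<nu>) X l) - A * exp (\<nu> * L) * (\<Sum>l. bessel_I_term \<nu> X l))"
    unfolding rs by (intro tendsto_intros Id_lim part)
  moreover have "Id k + 2 * pi * barnes_residue_sum (N1 + k) (N2 + k) \<nu> L = Ic" for k
    using shift[of k] by (simp add: algebra_simps)
  ultimately have "Ic = 2 * pi * (A * exp (- \<nu> * L) * (\<Sum>l. bessel_I_term (- \<nu>) X l) - A * exp (\<nu> * L) * (\<Sum>l. bessel_I_term \<nu> X l))"
    by (simp add: LIMSEQ_const_iff)
  also have "\<dots> = 2 * pi * (A * (bessel_I (- \<nu>) X - bessel_I \<nu> X))"
    unfolding bessel_I_eq[OF X] L_def by (simp only: right_diff_distrib mult.assoc)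
  also have "A * (bessel_I (- \<nu>) X - bessel_I \<nu> X) = bessel_K_nonint \<nu> X"
    unfolding bessel_K_nonint_def A_def by simp
  finally show ?thesis by (simp add: Ic_def L_def)
qed

text \<open>
  Dominated convergence: for \<open>\<mu>\<close> near \<open>\<nu>\<close> the real parts of the two Gamma arguments stay in a
  fixed compact subinterval of the positive axis.
\<close>
lemma barnes_integral_tendsto:
  assumes L: "\<bar>Im L\<bar> < pi / 4" and c: "c > \<bar>Re \<nu>\<bar>"
  shows "((\<lambda>\<mu>. LINT t|lborel. barnes_kernel \<mu> L (Complex c t)) \<longlongrightarrow>
     (LINT t|lborel. barnes_kernel \<nu> L (Complex c t))) (at \<nu>)"
proof (subst tendsto_at_iff_sequentially, intro allI impI)
  fix Y assume Y: "\<forall>i. Y i \<in> UNIV - {\<nu>}" "Y \<longlonglongrightarrow> \<nu>"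
  define \<delta> where "\<delta> = (c - \<bar>Re \<nu>\<bar>) / 2"
  have \<delta>: "\<delta> > 0" using c by (simp add: \<delta>_def)
  define I where "I = {\<delta> / 2..c + \<delta>}"
  have "continuous_on I (Gamma :: real \<Rightarrow> real)"
    by (intro continuous_intros) (use \<delta> in \<open>auto elim!: nonpos_Ints_cases simp: I_def\<close>)
  moreover have "compact I" by (simp add: I_def)
  ultimately have "bounded (Gamma ` I)" by (intro compact_imp_bounded compact_continuous_image)
  then obtain G where G: "G > 0" "\<And>u. u \<in> I \<Longrightarrow> \<bar>Gamma u\<bar> \<le> G"
    unfolding bounded_pos by fastforce
  define M where "M = G * G * 2 powr ((\<bar>c\<bar> + \<bar>c\<bar>) / 2 + 1) * exp (- (c * Re L))"
  have M: "M \<ge> 0" using G by (simp add: M_def)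
  have near: "\<bar>Re \<mu>\<bar> < \<bar>Re \<nu>\<bar> + \<delta>" if "dist \<mu> \<nu> < \<delta>" for \<mu>
    using that abs_Re_le_cmod[of "\<mu> - \<nu>"] by (simp add: dist_norm)
  have nz: "(c - Re \<mu>) / 2 \<notin> \<int>\<^sub>\<le>\<^sub>0" "(c + Re \<mu>) / 2 \<notin> \<int>\<^sub>\<le>\<^sub>0" if "\<bar>Re \<mu>\<bar> < c" for \<mu>
    using that by (auto elim!: nonpos_Ints_cases)
  have bound: "norm (barnes_kernel \<mu> L (Complex c t)) \<le> M * exp (- ((pi / 4 - \<bar>Im L\<bar>) * \<bar>t\<bar>))"
    if "dist \<mu> \<nu> < \<delta>" for \<mu> t
  proof -
    have *: "\<bar>Re \<mu>\<bar> < c" "\<bar>Re \<mu>\<bar> < c - \<delta>" using near[OF that] c by (simp_all add: \<delta>_def field_simps)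
    have "(c - Re \<mu>) / 2 \<in> I" "(c + Re \<mu>) / 2 \<in> I" using * \<delta> by (auto simp: I_def)
    hence **: "\<bar>Gamma ((c - Re \<mu>) / 2)\<bar> \<le> G" "\<bar>Gamma ((c + Re \<mu>) / 2)\<bar> \<le> G" using G by auto
    have "norm (barnes_kernel \<mu> L (Complex c t)) \<le>
        \<bar>Gamma ((c - Re \<mu>) / 2)\<bar> * \<bar>Gamma ((c + Re \<mu>) / 2)\<bar> *
        2 powr ((\<bar>c\<bar> + \<bar>Re \<mu>\<bar>) / 2 + 1) * exp (- (c * Re L)) * exp (- ((pi / 4 - \<bar>Im L\<bar>) * \<bar>t\<bar>))"
      by (rule barnes_kernel_bound) (use nz * in auto)
    also have "\<dots> \<le> M * exp (- ((pi / 4 - \<bar>Im L\<bar>) * \<bar>t\<bar>))"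
      unfolding M_def using * ** G by (intro mult_mono powr_mono) auto
    finally show ?thesis .
  qed
  have "\<forall>\<^sub>F i in sequentially. dist (Y i) \<nu> < \<delta>" using tendstoD[OF Y(2) \<delta>] .
  then obtain N where N: "\<And>i. i \<ge> N \<Longrightarrow> dist (Y i) \<nu> < \<delta>" by (auto simp: eventually_sequentially)
  have "(\<lambda>i. LINT t|lborel. barnes_kernel (Y (i + N)) L (Complex c t)) \<longlonglongrightarrow>
      (LINT t|lborel. barnes_kernel \<nu> L (Complex c t))"
  proof (rule integral_dominated_convergence)
    show "integrable lborel (\<lambda>t. M * exp (- ((pi / 4 - \<bar>Im L\<bar>) * \<bar>t\<bar>)))"
      using L by (intro integrable_mult_right integrable_exp_neg_abs) auto
    show "AE t in lborel. norm (barnes_kernel (Y (i + N)) L (Complex c t)) \<le> M * exp (- ((pi / 4 - \<bar>Im L\<bar>) * \<bar>t\<bar>))" for i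
      using bound[OF N] by simp
    have meas: "(\<lambda>t. barnes_kernel \<mu> L (Complex c t)) \<in> borel_measurable lborel" if "\<bar>Re \<mu>\<bar> < c" for \<mu>
      using borel_measurable_continuous_onI[OF continuous_on_barnes_kernel_line[OF nz[OF that]]] by simp
    show "(\<lambda>t. barnes_kernel \<nu> L (Complex c t)) \<in> borel_measurable lborel" using c by (intro meas)
    have "\<bar>Re (Y (i + N))\<bar> < c" for i
      using near[OF N[of "i + N"]] c by (simp add: \<delta>_def field_simps)
    thus "(\<lambda>t. barnes_kernel (Y (i + N)) L (Complex c t)) \<in> borel_measurable lborel" for i by (rule meas)
    have Y': "(\<lambda>i. Y (i + N)) \<longlonglongrightarrow> \<nu>" by (rule LIMSEQ_ignore_initial_segment[OF Y(2)])
    show "AE t in lborel. (\<lambda>i. barnes_kernel (Y (i + N)) L (Complex c t)) \<longlonglongrightarrow> barnes_kernel \<nu> L (Complex c t)"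
    proof (intro AE_I2)
      fix t
      have "(Complex c t - \<nu>) / 2 \<notin> \<int>\<^sub>\<le>\<^sub>0" "(Complex c t + \<nu>) / 2 \<notin> \<int>\<^sub>\<le>\<^sub>0"
        using nz[OF c] nonpos_Ints_Re[of "(Complex c t - \<nu>) / 2"] nonpos_Ints_Re[of "(Complex c t + \<nu>) / 2"] by auto
      thus "(\<lambda>i. barnes_kernel (Y (i + N)) L (Complex c t)) \<longlonglongrightarrow> barnes_kernel \<nu> L (Complex c t)"
        unfolding barnes_kernel_def by (intro tendsto_intros Y') auto
    qed
  qed
  thus "((\<lambda>\<mu>. LINT t|lborel. barnes_kernel \<mu> L (Complex c t)) \<circ> Y) \<longlonglongrightarrow>
      (LINT t|lborel. barnes_kernel \<nu> L (Complex c t))"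
    unfolding o_def by (rule LIMSEQ_offset)
qed

text \<open>
  At integer orders \<open>K\<^sub>\<nu>\<close> is the limit of the values at nearby orders, and so is the integral.
\<close>
theorem barnes_integral_eq_bessel_K:
  assumes X: "X \<noteq> 0" and L: "\<bar>Im (Ln (X / 2))\<bar> < pi / 4" and c: "c > \<bar>Re \<nu>\<bar>"
  shows "(LINT t|lborel. barnes_kernel \<nu> (Ln (X / 2)) (Complex c t)) = 2 * pi * bessel_K \<nu> X"
proof (cases "\<nu> \<in> \<int>")
  case False
  thus ?thesis using barnes_integral_nonint[OF False X L c] by (simp add: bessel_K_def)
next
  case True
  define F where "F = (\<lambda>\<mu>. LINT t|lborel. barnes_kernel \<mu> (Ln (X / 2)) (Complex c t))"
  have "(F \<longlongrightarrow> F \<nu>) (at \<nu>)"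
    unfolding F_def by (rule barnes_integral_tendsto[OF L c])
  hence "((\<lambda>\<mu>. F \<mu> / (2 * pi)) \<longlongrightarrow> F \<nu> / (2 * pi)) (at \<nu>)"
    by (intro tendsto_intros) auto
  moreover have "\<forall>\<^sub>F \<mu> in at \<nu>. F \<mu> / (2 * pi) = bessel_K_nonint \<mu> X"
  proof -
    have "open (- (\<int> - {\<nu>}))" by (intro open_Compl closed_subset_Ints) auto
    hence "\<forall>\<^sub>F \<mu> in at \<nu>. \<mu> \<in> - (\<int> - {\<nu>}) - {\<nu>}"
      by (intro eventually_at_in_open) auto
    moreover have "open {\<mu>. \<bar>Re \<mu>\<bar> < c}" by (intro open_Collect_less continuous_intros)
    hence "\<forall>\<^sub>F \<mu> in at \<nu>. \<mu> \<in> {\<mu>. \<bar>Re \<mu>\<bar> < c}"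
      using c by (intro eventually_at_in_open') auto
    ultimately show ?thesis
    proof eventually_elim
      case (elim \<mu>)
      thus ?case using barnes_integral_nonint[of \<mu> X c] X L by (simp add: F_def)
    qed
  qed
  ultimately have "((\<lambda>\<mu>. bessel_K_nonint \<mu> X) \<longlongrightarrow> F \<nu> / (2 * pi)) (at \<nu>)"
    by (rule Lim_transform_eventually)
  hence "bessel_K \<nu> X = F \<nu> / (2 * pi)"
    using True by (simp add: bessel_K_def tendsto_Lim)
  thus ?thesis by (simp add: F_def)
qed

section \<open>Series for the confluent hypergeometric factors\<close>

text \<open>
  The \<open>n\<close>-th term of \<open>Gamma a * hyp1F1 a (1 / 2) (- (w\<^sup>2 / 4))\<close>. The Gamma factor
  absorbs the Pochhammer symbol, and \<open>(1/2)\<^sub>n n! = (2 n)! / 4\<^sup>n\<close> cancels the powers of 4.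
\<close>
definition gamma_hyp_term :: "complex \<Rightarrow> complex \<Rightarrow> nat \<Rightarrow> complex" where
  "gamma_hyp_term w a n = Gamma (a + of_nat n) * (- (w\<^sup>2)) ^ n / fact (2 * n)"

text \<open>
  The part of the bound for \<open>gamma_hyp_term\<close> that depends only on the real part of the
  parameter; it dominates the series uniformly along a vertical line.
\<close>
definition gamma_hyp_bound :: "complex \<Rightarrow> real \<Rightarrow> nat \<Rightarrow> real" where
  "gamma_hyp_bound w \<sigma> n = Gamma (\<sigma> + real n) * 2 powr ((\<sigma> + real n) / 2) * (norm w ^ 2) ^ n / fact (2 * n)"

lemma gamma_hyp_bound_nonneg: "\<sigma> > 0 \<Longrightarrow> gamma_hyp_bound w \<sigma> n \<ge> 0"
  by (simp add: gamma_hyp_bound_def less_imp_le)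

lemma norm_gamma_hyp_term_le:
  assumes "Re a > 0"
  shows "norm (gamma_hyp_term w a n) \<le> gamma_hyp_bound w (Re a) n * exp (- (pi * \<bar>Im a\<bar> / 4))"
proof -
  have "norm (gamma_hyp_term w a n) = norm (Gamma (a + of_nat n)) * ((norm w ^ 2) ^ n / fact (2 * n))"
    by (simp add: gamma_hyp_term_def norm_mult norm_divide norm_power)
  also have "\<dots> \<le> (Gamma (Re a + real n) * 2 powr ((Re a + real n) / 2) * exp (- (pi * \<bar>Im a\<bar> / 4))) *
      ((norm w ^ 2) ^ n / fact (2 * n))"
    using norm_Gamma_decay[of "a + of_nat n"] assms by (intro mult_right_mono) auto
  finally show ?thesis by (simp add: gamma_hyp_bound_def mult_ac)
qed

lemma summable_gamma_hyp_bound: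
  assumes \<sigma>: "\<sigma> > 0"
  shows "summable (gamma_hyp_bound w \<sigma>)"
proof (rule summable_ratio_test)
  define N where "N = nat \<lceil>\<sigma> + 2 * norm w ^ 2\<rceil>"
  show "(1 / 2 :: real) < 1" by simp
  fix n assume "n \<ge> N"
  hence n: "real n \<ge> \<sigma> + 2 * norm w ^ 2" unfolding N_def by linarith
  define v where "v = norm w ^ 2"
  have v: "v \<ge> 0" by (simp add: v_def)
  define D where "D = (2 * real n + 2) * (2 * real n + 1)"
  have D: "D > 0" unfolding D_def by (intro mult_pos_pos) auto
  have "(\<sigma> + real n) * (2 powr (1 / 2) * v) \<le> (2 * real n + 2) * (1 / 2 * (2 * real n + 1))"
  proof (rule mult_mono)
    show "\<sigma> + real n \<le> 2 * real n + 2" using n v unfolding v_def[symmetric] by linarith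
    have "2 powr (1 / 2) \<le> (2 :: real) powr 1" by (rule powr_mono) auto
    hence "2 powr (1 / 2) * v \<le> 2 * v" using v by (intro mult_right_mono) auto
    also have "\<dots> \<le> real n" using n \<sigma> unfolding v_def[symmetric] by linarith
    also have "\<dots> \<le> 1 / 2 * (2 * real n + 1)" by simp
    finally show "2 powr (1 / 2) * v \<le> 1 / 2 * (2 * real n + 1)" .
  qed (use v in auto)
  hence le: "(\<sigma> + real n) * (2 powr (1 / 2) * v) / D \<le> 1 / 2"
    using D by (simp add: D_def divide_simps)
  have nn: "\<sigma> + real n \<notin> \<int>\<^sub>\<le>\<^sub>0" using \<sigma> by (auto elim!: nonpos_Ints_cases)
  have "Gamma (\<sigma> + real (Suc n)) = (\<sigma> + real n) * Gamma (\<sigma> + real n)"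
    using Gamma_plus1[OF nn] by (simp add: add_ac)
  moreover have "2 powr ((\<sigma> + real (Suc n)) / 2) = 2 powr ((\<sigma> + real n) / 2) * (2 :: real) powr (1 / 2)"
    by (simp add: add_divide_distrib add_ac flip: powr_add)
  moreover have "fact (2 * Suc n) = D * fact (2 * n)"
    by (simp add: D_def algebra_simps)
  ultimately have "gamma_hyp_bound w \<sigma> (Suc n) =
      gamma_hyp_bound w \<sigma> n * ((\<sigma> + real n) * (2 powr (1 / 2) * v) / D)"
    by (simp add: gamma_hyp_bound_def v_def mult_ac)
  also have "\<dots> \<le> gamma_hyp_bound w \<sigma> n * (1 / 2)"
    by (intro mult_left_mono le gamma_hyp_bound_nonneg \<sigma>)
  finally show "norm (gamma_hyp_bound w \<sigma> (Suc n)) \<le> 1 / 2 * norm (gamma_hyp_bound w \<sigma> n)"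
    using gamma_hyp_bound_nonneg[OF \<sigma>] by simp
qed

lemma gamma_hyp_term_sums:
  assumes a: "Re a > 0"
  shows "gamma_hyp_term w a sums (Gamma a * hyp1F1 a (1 / 2) (- (w\<^sup>2 / 4)))"
proof -
  have an: "a \<notin> \<int>\<^sub>\<le>\<^sub>0" using a by (auto elim!: nonpos_Ints_cases)
  hence G: "Gamma a \<noteq> 0" by (simp add: Gamma_eq_zero_iff)
  have eq: "gamma_hyp_term w a n = Gamma a * (pochhammer a n * (- (w\<^sup>2 / 4)) ^ n / (pochhammer (1 / 2) n * fact n))" for n
  proof -
    have f: "fact (2 * n) = (4 :: complex) ^ n * (pochhammer (1 / 2) n * fact n)"
      by (simp add: fact_double power_mult mult.assoc)
    have g: "Gamma (a + of_nat n) = Gamma a * pochhammer a n"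
      using pochhammer_Gamma[OF an, of n] G by simp
    have "- (w\<^sup>2 / 4) = - (w\<^sup>2) / 4" by simp
    hence p: "(- (w\<^sup>2 / 4)) ^ n = (- (w\<^sup>2)) ^ n / 4 ^ n" by (simp only: power_divide)
    show ?thesis unfolding gamma_hyp_term_def f g p by simp
  qed
  have sm: "summable (gamma_hyp_term w a)"
  proof (rule summable_comparison_test')
    show "summable (\<lambda>n. gamma_hyp_bound w (Re a) n * exp (- (pi * \<bar>Im a\<bar> / 4)))"
      by (intro summable_mult2 summable_gamma_hyp_bound a)
  qed (rule norm_gamma_hyp_term_le[OF a])
  hence "summable (\<lambda>n. pochhammer a n * (- (w\<^sup>2 / 4)) ^ n / (pochhammer (1 / 2) n * fact n))"
    unfolding eq[abs_def] using G by (simp only: summable_cmult_iff) simp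
  hence "(\<lambda>n. Gamma a * (pochhammer a n * (- (w\<^sup>2 / 4)) ^ n / (pochhammer (1 / 2) n * fact n))) sums (Gamma a * hyp1F1 a (1 / 2) (- (w\<^sup>2 / 4)))"
    unfolding hyp1F1_def by (intro sums_mult summable_sums)
  thus ?thesis unfolding eq[abs_def] .
qed

section \<open>Diagonal sums as Bessel functions\<close>

text \<open>
  In \<open>I\<^bsub>2N\<^esub> + J\<^bsub>2N\<^esub>\<close> the terms of odd index cancel and those of even index double, which
  leaves a series over \<open>1 / ((2 m)! (2 n)!)\<close> with \<open>n - m = N\<close>. For negative \<open>N\<close> the indices \<open>m < - N\<close>
  drop out because \<open>rGamma\<close> vanishes there, which matches the restriction to \<open>n \<ge> 0\<close>.
\<close>
lemma bessel_series_diagonal: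
  fixes u :: complex and N :: int
  shows "((\<lambda>m. (u\<^sup>2) ^ (m + nat (int m + N)) / (fact (2 * m) * fact (2 * nat (int m + N)))) has_sum
     (bessel_I (of_int (2 * N)) (2 * u) + bessel_J (of_int (2 * N)) (2 * u)) / 2) {m. int m + N \<ge> 0}"
proof (cases "u = 0")
  case True
  \<comment> \<open>At \<open>u = 0\<close> the factor \<open>principal_pow 0\<close> leaves only the order 0, and there only the first term.\<close>
  have sum0: "(\<Sum>m. c m * (0 :: complex) ^ (2 * m) * rGamma (of_nat m + 1) / fact m) = c 0" for c :: "nat \<Rightarrow> complex"
  proof -
    have "(\<lambda>m. c m * (0 :: complex) ^ (2 * m) * rGamma (of_nat m + 1) / fact m) sums
       (\<Sum>m\<in>{0}. c m * (0 :: complex) ^ (2 * m) * rGamma (of_nat m + 1) / fact m)"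
      by (rule sums_finite) auto
    thus ?thesis by (simp add: sums_iff)
  qed
  have "(bessel_I (of_int (2 * N)) (2 * u) + bessel_J (of_int (2 * N)) (2 * u)) / 2 = (if N = 0 then 1 else 0)"
    using sum0[of "\<lambda>_. 1"] sum0[of "\<lambda>m. (-1) ^ m"] True
    by (simp add: bessel_I_def bessel_J_def principal_pow_def)
  moreover have "((\<lambda>m. (u\<^sup>2) ^ (m + nat (int m + N)) / (fact (2 * m) * fact (2 * nat (int m + N)))) has_sum
      (if N = 0 then 1 else 0)) {m. int m + N \<ge> 0}"
  proof (cases "N = 0")
    case True
    show ?thesis
      by (rule has_sum_finite_neutralI[of "{0}"]) (use True \<open>u = 0\<close> in auto)
  next
    case False
    show ?thesis
      by (rule has_sum_finite_neutralI[of "{}"]) (use False \<open>u = 0\<close> in auto)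
  qed
  ultimately show ?thesis by (simp only:)
next
  case u: False
  define P where "P = u powi (2 * N)"
  define h where "h = (\<lambda>m. (u\<^sup>2) ^ m * rGamma (of_int (2 * N) + of_nat m + 1) / fact m)"
  define g where "g = (\<lambda>m. ((-(u\<^sup>2)) ^ m * rGamma (of_int (2 * N) + of_nat m + 1) / fact m))"
  have h: "summable (\<lambda>m. norm (h m))" and g: "summable (\<lambda>m. norm (g m))"
    unfolding h_def g_def by (rule summable_bessel_series)+
  have "u powr of_int (2 * N) = P"
    using u exp_power_int[of "Ln u" "2 * N"] by (simp add: powr_def P_def mult.commute)
  hence pp: "principal_pow (2 * u / 2) (of_int (2 * N)) = P"
    by (auto simp: principal_pow_def P_def)
  have I: "bessel_I (of_int (2 * N)) (2 * u) = P * suminf h"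
    unfolding bessel_I_def pp h_def by (simp add: power_mult)
  have neg: "(- (u\<^sup>2)) ^ m = (- 1) ^ m * (u\<^sup>2) ^ m" for m
    by (metis mult_minus1 power_mult_distrib)
  have J: "bessel_J (of_int (2 * N)) (2 * u) = P * suminf g"
    unfolding bessel_J_def pp g_def neg by (simp add: power_mult)
  have "(h has_sum suminf h) UNIV" "(g has_sum suminf g) UNIV"
    using h g by (auto intro!: norm_summable_imp_has_sum summable_sums dest: summable_norm_cancel)
  from has_sum_cmult_right[OF has_sum_add[OF this], of "P / 2"]
  have "((\<lambda>m. P / 2 * (h m + g m)) has_sum P / 2 * (suminf h + suminf g)) UNIV" .
  also have "P / 2 * (suminf h + suminf g) = (bessel_I (of_int (2 * N)) (2 * u) + bessel_J (of_int (2 * N)) (2 * u)) / 2"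
    unfolding I J by (simp add: algebra_simps)
  finally have *: "((\<lambda>m. P / 2 * (h m + g m)) has_sum
      (bessel_I (of_int (2 * N)) (2 * u) + bessel_J (of_int (2 * N)) (2 * u)) / 2) UNIV" .
  have "((\<lambda>m. P / 2 * (h m + g m)) has_sum
      (bessel_I (of_int (2 * N)) (2 * u) + bessel_J (of_int (2 * N)) (2 * u)) / 2) (range ((*) 2))"
    using * 
  proof (rule has_sum_cong_neutral[THEN iffD1, rotated -1])
    fix m :: nat assume "m \<in> UNIV - range ((*) 2)"
    hence "odd m" by auto
    thus "P / 2 * (h m + g m) = 0" by (simp add: h_def g_def)
  qed auto
  hence "((\<lambda>j. P / 2 * (h (2 * j) + g (2 * j))) has_sum
      (bessel_I (of_int (2 * N)) (2 * u) + bessel_J (of_int (2 * N)) (2 * u)) / 2) UNIV"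
    by (subst (asm) has_sum_reindex) (auto simp: inj_on_def o_def)
  thus ?thesis
  proof (rule has_sum_cong_neutral[THEN iffD1, rotated -1])
    fix j :: nat assume "j \<in> UNIV - {m. int m + N \<ge> 0}"
    hence "2 * N + int (2 * j) + 1 \<le> 0" by auto
    hence "rGamma (of_int (2 * N + int (2 * j) + 1) :: complex) = 0"
      by (subst rGamma_of_int) auto
    thus "P / 2 * (h (2 * j) + g (2 * j)) = 0" by (simp add: h_def g_def)
  next
    fix j :: nat assume "j \<in> UNIV \<inter> {m. int m + N \<ge> 0}"
    hence j: "int j + N \<ge> 0" by simp
    define n where "n = nat (int j + N)"
    have n: "N = int n - int j" using j by (simp add: n_def)
    have "of_int (2 * N) + of_nat (2 * j) + 1 = (of_int (2 * N + int (2 * j) + 1) :: complex)" by simp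
    also have "rGamma \<dots> = inverse (fact (2 * n))"
      by (subst rGamma_of_int) (simp add: n nat_mult_distrib)
    finally have r: "rGamma (of_int (2 * N) + of_nat (2 * j) + 1) = inverse (fact (2 * n) :: complex)" .
    have "P * (u\<^sup>2) ^ (2 * j) = u powi (2 * N) * u powi (int (2 * (2 * j)))"
      by (simp only: P_def power_int_of_nat power_mult)
    also have "\<dots> = u powi (2 * N + int (2 * (2 * j)))"
      by (rule power_int_add[symmetric]) (use u in simp)
    also have "2 * N + int (2 * (2 * j)) = int (2 * (j + n))" by (simp add: n)
    also have "u powi int (2 * (j + n)) = (u\<^sup>2) ^ (j + n)"
      by (simp only: power_int_of_nat power_mult)
    finally have p: "P * (u\<^sup>2) ^ (2 * j) = (u\<^sup>2) ^ (j + n)" .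
    have "P / 2 * (h (2 * j) + g (2 * j)) = P * (u\<^sup>2) ^ (2 * j) * inverse (fact (2 * n)) / fact (2 * j)"
      unfolding h_def g_def neg r by simp
    also have "\<dots> = (u\<^sup>2) ^ (j + n) / (fact (2 * j) * fact (2 * n))"
      unfolding p by (simp add: divide_inverse mult_ac)
    finally show "P / 2 * (h (2 * j) + g (2 * j)) =
        (u\<^sup>2) ^ (j + nat (int j + N)) / (fact (2 * j) * fact (2 * nat (int j + N)))"
      by (simp add: n_def)
  qed auto
qed

lemma filterlim_square_finite_subsets:
  "filterlim (\<lambda>N. {..<N} \<times> {..<N}) (finite_subsets_at_top (UNIV :: (nat \<times> nat) set)) sequentially"
proof (subst filterlim_finite_subsets_at_top, safe)
  fix X :: "(nat \<times> nat) set" assume X: "finite X"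
  hence "finite (fst ` X \<union> snd ` X)" by simp
  then obtain M where M: "fst ` X \<union> snd ` X \<subseteq> {..<M}"
    using finite_nat_iff_bounded by blast
  show "\<forall>\<^sub>F N in sequentially. finite ({..<N} \<times> {..<N}) \<and> X \<subseteq> {..<N} \<times> {..<N} \<and> {..<N} \<times> {..<N} \<subseteq> UNIV"
    using eventually_ge_at_top[of M]
  proof eventually_elim
    case (elim N)
    thus ?case using M by fastforce
  qed
qed

lemma has_sum_by_diagonals:
  fixes T :: "nat \<times> nat \<Rightarrow> complex"
  assumes T: "(T has_sum S) UNIV"
    and D: "\<And>N::int. ((\<lambda>m. T (m, nat (int m + N))) has_sum d N) {m. int m + N \<ge> 0}"
  shows "(d has_sum S) UNIV"
proof -
  define B where "B = (\<lambda>N::int. {m. int m + N \<ge> 0})"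
  have bij: "bij_betw (\<lambda>(N, m). (m, nat (int m + N))) (Sigma UNIV B) UNIV"
    by (rule bij_betwI[where g = "\<lambda>(m, n). (int n - int m, m)"]) (auto simp: B_def)
  have "((\<lambda>p. T (case p of (N, m) \<Rightarrow> (m, nat (int m + N)))) has_sum S) (Sigma UNIV B)"
    using has_sum_reindex_bij_betw[OF bij, of T S] T by simp
  thus ?thesis
    by (rule has_sum_Sigma') (use D in \<open>auto simp: B_def\<close>)
qed

section \<open>Termwise integration\<close>

text \<open>
  The heart of the expansion: multiplying out the two hypergeometric series shifts the arguments of
  the Gamma factors by \<open>m\<close> and \<open>n\<close>, and this is the same as shifting \<open>s\<close> by \<open>m + n\<close>
  and the order \<open>z\<close> by \<open>n - m\<close>.
\<close>
lemma expanded_integrand_eq_barnes_kernel: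
  assumes "x \<noteq> 0"
  shows "gamma_hyp_term w ((s - z) / 2) m * gamma_hyp_term w ((s + z) / 2) n * exp (- (s * Ln x)) / 4 =
    (- 1) powi (int n - int m) * ((w\<^sup>2 * x) ^ (m + n) / (fact (2 * m) * fact (2 * n))) *
    barnes_kernel (z + of_int (int n - int m)) (Ln x) (s + of_nat (m + n))"
proof -
  have args: "(s + of_nat (m + n) - (z + of_int (int n - int m))) / 2 = (s - z) / 2 + of_nat m"
    "(s + of_nat (m + n) + (z + of_int (int n - int m))) / 2 = (s + z) / 2 + of_nat n"
    by (simp_all add: field_simps)
  have "exp (- ((s + of_nat (m + n)) * Ln x)) = exp (- (s * Ln x)) / exp (of_nat (m + n) * Ln x)"
  proof -
    have "- ((s + of_nat (m + n)) * Ln x) = - (s * Ln x) - of_nat (m + n) * Ln x"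
      by (simp only: ring_distribs minus_add_distrib diff_conv_add_uminus)
    thus ?thesis by (simp only: exp_diff)
  qed
  also have "exp (of_nat (m + n) * Ln x) = x ^ (m + n)"
    unfolding exp_of_nat_mult using assms by simp
  finally have e: "exp (- ((s + of_nat (m + n)) * Ln x)) = exp (- (s * Ln x)) / x ^ (m + n)" .
  \<comment> \<open>An even shift of the exponent makes it a natural number.\<close>
  have "(- 1 :: complex) powi (int n - int m) = (- 1) powi (int n - int m + 2 * int m)"
    by (simp add: power_int_minus_left)
  also have "int n - int m + 2 * int m = int (m + n)" by simp
  finally have sgn: "(- 1 :: complex) powi (int n - int m) = (- 1) ^ (m + n)" by (simp only: power_int_of_nat)
  have "(- (w\<^sup>2)) ^ m * (- (w\<^sup>2)) ^ n = ((- 1) * w\<^sup>2) ^ (m + n)" by (simp add: power_add)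
  also have "\<dots> = (- 1) ^ (m + n) * (w\<^sup>2) ^ (m + n)" by (simp only: power_mult_distrib)
  finally have pw: "(- (w\<^sup>2)) ^ m * (- (w\<^sup>2)) ^ n = (- 1) ^ (m + n) * (w\<^sup>2) ^ (m + n)" .
  define G1 where "G1 = Gamma ((s - z) / 2 + of_nat m)"
  define G2 where "G2 = Gamma ((s + z) / 2 + of_nat n)"
  have "gamma_hyp_term w ((s - z) / 2) m * gamma_hyp_term w ((s + z) / 2) n * exp (- (s * Ln x)) / 4 =
     ((- (w\<^sup>2)) ^ m * (- (w\<^sup>2)) ^ n) / (fact (2 * m) * fact (2 * n)) * (G1 * G2 * exp (- (s * Ln x)) / 4)"
    unfolding gamma_hyp_term_def G1_def[symmetric] G2_def[symmetric] by (simp add: mult_ac)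
  also have "\<dots> = (- 1) ^ (m + n) * ((w\<^sup>2) ^ (m + n) * x ^ (m + n) / (fact (2 * m) * fact (2 * n))) *
      (G1 * G2 * (exp (- (s * Ln x)) / x ^ (m + n)) / 4)"
    unfolding pw using assms by (simp add: mult_ac)
  finally show ?thesis
    unfolding sgn power_mult_distrib barnes_kernel_def args e G1_def G2_def .
qed

lemma sum_mult_sum_mult:
  fixes f g :: "_ \<Rightarrow> 'a :: comm_semiring_0"
  shows "(\<Sum>m\<in>A. f m) * (\<Sum>n\<in>B. g n) * c = (\<Sum>m\<in>A. \<Sum>n\<in>B. f m * g n * c)"
  by (simp only: sum_product, simp only: sum_distrib_right)

text \<open>
  Partial sums are taken over squares, where the double sum factorizes.
\<close>
lemma gen_bessel_K_integrand_sums: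
  assumes x: "x \<noteq> 0" and s: "Re s > \<bar>Re z\<bar>"
  shows "(\<lambda>N. \<Sum>m<N. \<Sum>n<N. gamma_hyp_term w ((s - z) / 2) m * gamma_hyp_term w ((s + z) / 2) n *
      exp (- (s * Ln x)) / 4) \<longlonglongrightarrow> gen_bessel_K_integrand z w (2 * x) s"
proof -
  have pos: "Re ((s - z) / 2) > 0" "Re ((s + z) / 2) > 0" using s by auto
  have "Ln (2 * x) = ln 2 + Ln x"
    using Ln_times_of_real[of 2 x] x by simp
  hence "- s * Ln (2 * x) = - (s * ln 2) - s * Ln x"
    by (simp only: ring_distribs mult_minus_left diff_conv_add_uminus)
  hence "(2 * x) powr (- s) = exp (- (s * ln 2) - s * Ln x)"
    using x by (simp add: powr_def)
  moreover have "2 powr (s - 2) = exp (s * ln 2 - 2 * ln (2 :: complex))"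
    by (simp add: powr_def algebra_simps)
  ultimately have "2 powr (s - 2) * (2 * x) powr (- s) = exp (- (s * Ln x) - 2 * ln 2)"
    by (simp add: add_ac flip: exp_add)
  also have "\<dots> = exp (- (s * Ln x)) / 4"
    by (simp add: exp_diff exp_double)
  finally have pw: "2 powr (s - 2) * (2 * x) powr (- s) = exp (- (s * Ln x)) / 4" .
  have "(\<lambda>N. (\<Sum>m<N. gamma_hyp_term w ((s - z) / 2) m) * (\<Sum>n<N. gamma_hyp_term w ((s + z) / 2) n) *
      (exp (- (s * Ln x)) / 4)) \<longlonglongrightarrow>
      (Gamma ((s - z) / 2) * hyp1F1 ((s - z) / 2) (1 / 2) (- (w\<^sup>2 / 4))) *
      (Gamma ((s + z) / 2) * hyp1F1 ((s + z) / 2) (1 / 2) (- (w\<^sup>2 / 4))) * (exp (- (s * Ln x)) / 4)"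
    using gamma_hyp_term_sums[OF pos(1)] gamma_hyp_term_sums[OF pos(2)]
    unfolding sums_def by (intro tendsto_intros)
  also have "(Gamma ((s - z) / 2) * hyp1F1 ((s - z) / 2) (1 / 2) (- (w\<^sup>2 / 4))) *
      (Gamma ((s + z) / 2) * hyp1F1 ((s + z) / 2) (1 / 2) (- (w\<^sup>2 / 4))) * (exp (- (s * Ln x)) / 4) =
      gen_bessel_K_integrand z w (2 * x) s"
    unfolding gen_bessel_K_integrand_def pw[symmetric] by (simp only: mult_ac)
  finally show ?thesis
    by (simp only: sum_mult_sum_mult, simp only: times_divide_eq_right)
qed

lemma summable_on_product_nat:
  fixes f g :: "nat \<Rightarrow> real"
  assumes "summable f" "summable g" "\<And>n. f n \<ge> 0" "\<And>n. g n \<ge> 0"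
  shows "(\<lambda>(m, n). f m * g n) summable_on UNIV"
proof -
  have "(f has_sum suminf f) UNIV" "(g has_sum suminf g) UNIV"
    using assms by (auto intro!: norm_summable_imp_has_sum summable_sums)
  note sums = this
  have "(\<lambda>m. f m * suminf g) summable_on UNIV"
    by (rule has_sum_imp_summable[OF has_sum_cmult_left[OF sums(1)]])
  hence "(\<lambda>(m, n). f m * g n) summable_on Sigma UNIV (\<lambda>_. UNIV)"
    by (rule summable_on_SigmaI[rotated])
       (use assms(3,4) has_sum_cmult_right[OF sums(2)] in auto)
  thus ?thesis by simp
qed

theorem theorem1p9:
  fixes z w x :: complex and c :: real
  assumes "- (1 / 2) < Re z" and "Re z < 1 / 2"
    and "x \<noteq> 0" and "\<bar>Arg x\<bar> < pi / 4"
    and "c > \<bar>Re z\<bar>"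
  shows "integrable lborel (\<lambda>t. gen_bessel_K_integrand z w (2 * x) (Complex c t)) \<and>
    (\<lambda>n::int. (- 1) powi n * bessel_K (z + of_int n) (2 * x) *
       (bessel_I (of_int (2 * n)) (2 * w * csqrt x) + bessel_J (of_int (2 * n)) (2 * w * csqrt x)))
      summable_on UNIV \<and>
    gen_bessel_K c z w (2 * x) =
      1 / 2 * (\<Sum>\<^sub>\<infinity>n::int. (- 1) powi n * bessel_K (z + of_int n) (2 * x) *
        (bessel_I (of_int (2 * n)) (2 * w * csqrt x) + bessel_J (of_int (2 * n)) (2 * w * csqrt x)))"
proof -
  define L where "L = Ln x"
  have L: "\<bar>Im L\<bar> < pi / 4" using assms by (simp add: L_def Arg_eq_Im_Ln)
  define \<sigma>1 \<sigma>2 where "\<sigma>1 = (c - Re z) / 2" and "\<sigma>2 = (c + Re z) / 2"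
  have \<sigma>: "\<sigma>1 > 0" "\<sigma>2 > 0" using assms by (auto simp: \<sigma>1_def \<sigma>2_def)
  define f where "f = (\<lambda>m n t. gamma_hyp_term w ((Complex c t - z) / 2) m * gamma_hyp_term w ((Complex c t + z) / 2) n *
      exp (- (Complex c t * L)) / 4)"
  define F where "F = (\<lambda>t. gen_bessel_K_integrand z w (2 * x) (Complex c t))"
  define B where "B = gamma_hyp_bound w"
  define h where "h = (\<lambda>t. exp (- (c * Re L)) * exp (- ((pi / 4 - \<bar>Im L\<bar>) * \<bar>t\<bar>)))"
  define q where "q = w\<^sup>2 * x"
  define coeff where "coeff = (\<lambda>m n. (- 1) powi (int n - int m) * (q ^ (m + n) / (fact (2 * m) * fact (2 * n))))"
  have h: "integrable lborel h" unfolding h_def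
    using L by (intro integrable_mult_right integrable_exp_neg_abs) auto
  have h0: "h t \<ge> 0" for t by (simp add: h_def)
  have B0: "B \<sigma>1 m \<ge> 0" "B \<sigma>2 m \<ge> 0" for m
    unfolding B_def by (intro gamma_hyp_bound_nonneg \<sigma>)+
  have Bsum: "summable (B \<sigma>1)" "summable (B \<sigma>2)"
    unfolding B_def by (intro summable_gamma_hyp_bound \<sigma>)+
  have f_barnes: "f m n = (\<lambda>t. coeff m n * barnes_kernel (z + of_int (int n - int m)) L (Complex (c + real (m + n)) t))" for m n
  proof
    fix t
    have "Complex (c + real (m + n)) t = Complex c t + of_nat (m + n)" by (simp add: complex_eq_iff)
    thus "f m n t = coeff m n * barnes_kernel (z + of_int (int n - int m)) L (Complex (c + real (m + n)) t)"
      unfolding f_def coeff_def q_def L_def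
      by (simp only: expanded_integrand_eq_barnes_kernel[OF assms(3)])
  qed
  \<comment> \<open>The shifted abscissa remains admissible for the shifted order.\<close>
  have order: "c + real (m + n) > \<bar>Re (z + of_int (int n - int m))\<bar>" for m n
    using assms by auto
  have f_int: "integrable lborel (f m n)" for m n
  proof -
    define r where "r = Re (z + of_int (int n - int m))"
    have pos: "y \<notin> \<int>\<^sub>\<le>\<^sub>0" if "y > 0" for y :: real using that by (auto elim!: nonpos_Ints_cases)
    have "(c + real (m + n) - r) / 2 > 0" "(c + real (m + n) + r) / 2 > 0"
      using order[where m = m and n = n] unfolding r_def[symmetric] by (simp_all add: abs_less_iff)
    thus ?thesis
      unfolding f_barnes using L
      by (intro integrable_mult_right integrable_barnes_kernel(1) pos) (simp_all only: r_def)
  qed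
  have f_integral: "(LINT t|lborel. f m n t) = coeff m n * (2 * pi * bessel_K (z + of_int (int n - int m)) (2 * x))" for m n
    using barnes_integral_eq_bessel_K[of "2 * x" "z + of_int (int n - int m)" "c + real (m + n)"] order[where m = m and n = n] L assms(3)
    unfolding f_barnes by (simp add: L_def)
  have f_bound: "norm (f m n t) \<le> B \<sigma>1 m * B \<sigma>2 n * h t" for m n t
  proof -
    define a where "a = (Complex c t - z) / 2"
    define b where "b = (Complex c t + z) / 2"
    have ab: "Re a = \<sigma>1" "Im a = (t - Im z) / 2" "Re b = \<sigma>2" "Im b = (t + Im z) / 2"
      by (simp_all add: a_def b_def \<sigma>1_def \<sigma>2_def)
    have "norm (f m n t) \<le> norm (gamma_hyp_term w a m) * norm (gamma_hyp_term w b n) * norm (exp (- (Complex c t * L)))"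
      by (simp add: f_def a_def b_def norm_mult norm_divide)
    also have "\<dots> \<le> (B \<sigma>1 m * exp (- (pi * \<bar>Im a\<bar> / 4))) * (B \<sigma>2 n * exp (- (pi * \<bar>Im b\<bar> / 4))) *
        (exp (- (c * Re L)) * exp (\<bar>Im L\<bar> * \<bar>t\<bar>))"
      using norm_gamma_hyp_term_le[of a w m] norm_gamma_hyp_term_le[of b w n] B0 \<sigma>
      by (intro mult_mono exp_vertical_bound) (auto simp: ab B_def)
    also have "\<dots> = B \<sigma>1 m * B \<sigma>2 n * exp (- (c * Re L)) * exp (\<bar>Im L\<bar> * \<bar>t\<bar>) *
        (exp (- (pi * \<bar>Im a\<bar> / 4)) * exp (- (pi * \<bar>Im b\<bar> / 4)))"
      by (simp only: mult_ac)
    also have "\<dots> \<le> B \<sigma>1 m * B \<sigma>2 n * exp (- (c * Re L)) * exp (\<bar>Im L\<bar> * \<bar>t\<bar>) * exp (- (pi / 4 * \<bar>t\<bar>))"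
      unfolding ab by (intro mult_left_mono exp_decay_product_le mult_nonneg_nonneg B0) auto
    also have "\<dots> = B \<sigma>1 m * B \<sigma>2 n * h t"
      by (simp add: h_def algebra_simps flip: exp_add)
    finally show ?thesis .
  qed
  have lim: "(\<lambda>N. \<Sum>m<N. \<Sum>n<N. f m n t) \<longlonglongrightarrow> F t" for t
    unfolding f_def F_def L_def using assms by (intro gen_bessel_K_integrand_sums) auto
  have partial_bound: "norm (\<Sum>m<N. \<Sum>n<N. f m n t) \<le> suminf (B \<sigma>1) * suminf (B \<sigma>2) * h t" for N t
  proof -
    have "norm (\<Sum>m<N. \<Sum>n<N. f m n t) \<le> (\<Sum>m<N. \<Sum>n<N. B \<sigma>1 m * B \<sigma>2 n * h t)"
      by (intro sum_norm_le f_bound)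
    also have "\<dots> = (\<Sum>m<N. B \<sigma>1 m) * (\<Sum>n<N. B \<sigma>2 n) * h t"
      by (rule sum_mult_sum_mult[symmetric])
    also have "\<dots> \<le> suminf (B \<sigma>1) * suminf (B \<sigma>2) * h t"
      using Bsum B0 h0 by (intro mult_mono sum_le_suminf sum_nonneg mult_nonneg_nonneg suminf_nonneg) auto
    finally show ?thesis .
  qed
  have H: "integrable lborel (\<lambda>t. suminf (B \<sigma>1) * suminf (B \<sigma>2) * h t)"
    using h by (intro integrable_mult_right)
  have f_meas: "(\<lambda>t. \<Sum>m<N. \<Sum>n<N. f m n t) \<in> borel_measurable lborel" for N
    by (intro borel_measurable_sum borel_measurable_integrable f_int)
  have F_meas: "F \<in> borel_measurable lborel"
    by (rule borel_measurable_LIMSEQ_metric[OF f_meas lim])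
  have F_int: "integrable lborel F"
    by (rule integrable_dominated_convergence[OF F_meas f_meas H AE_I2[OF lim] AE_I2[OF partial_bound]])
  define T where "T = (\<lambda>(m, n). LINT t|lborel. f m n t)"
  have "(\<lambda>N. LINT t|lborel. (\<Sum>m<N. \<Sum>n<N. f m n t)) \<longlonglongrightarrow> (LINT t|lborel. F t)"
    by (rule integral_dominated_convergence[OF F_meas f_meas H AE_I2[OF lim] AE_I2[OF partial_bound]])
  also have "(\<lambda>N. LINT t|lborel. (\<Sum>m<N. \<Sum>n<N. f m n t)) = (\<lambda>N. sum T ({..<N} \<times> {..<N}))"
    unfolding T_def sum.cartesian_product[symmetric]
    by (simp add: f_int Bochner_Integration.integral_sum Bochner_Integration.integrable_sum)
  finally have T_lim: "(\<lambda>N. sum T ({..<N} \<times> {..<N})) \<longlonglongrightarrow> (LINT t|lborel. F t)" .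
  \<comment> \<open>Absolute summability is read off from the integrals, without estimates of \<open>K\<close> at large order.\<close>
  have T_bound: "norm (T p) \<le> (case p of (m, n) \<Rightarrow> B \<sigma>1 m * B \<sigma>2 n) * (LINT t|lborel. h t)" for p
  proof (cases p)
    case (Pair m n)
    have "norm (LINT t|lborel. f m n t) \<le> (LINT t|lborel. B \<sigma>1 m * B \<sigma>2 n * h t)"
      using h by (intro Bochner_Integration.integral_norm_bound_integral f_int f_bound integrable_mult_right)
    thus ?thesis by (simp add: T_def Pair)
  qed
  have "(\<lambda>p. (case p of (m, n) \<Rightarrow> B \<sigma>1 m * B \<sigma>2 n) * (LINT t|lborel. h t)) summable_on UNIV"
    by (intro summable_on_cmult_left summable_on_product_nat Bsum B0)
  hence "(\<lambda>p. norm (T p)) summable_on UNIV"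
    by (rule Infinite_Sum.abs_summable_on_comparison_test') (rule T_bound)
  hence "T summable_on UNIV" by (rule Infinite_Sum.abs_summable_summable)
  hence T_sum: "(T has_sum infsum T UNIV) UNIV" by (rule has_sum_infsum)
  hence "(\<lambda>N. sum T ({..<N} \<times> {..<N})) \<longlonglongrightarrow> infsum T UNIV"
    unfolding has_sum_def by (rule filterlim_compose[OF _ filterlim_square_finite_subsets])
  hence "infsum T UNIV = (LINT t|lborel. F t)"
    using T_lim by (rule LIMSEQ_unique)
  with T_sum have T_sum: "(T has_sum (LINT t|lborel. F t)) UNIV" by simp
  define u where "u = w * csqrt x"
  have uq: "u\<^sup>2 = q" by (simp add: u_def q_def power_mult_distrib)
  have u2: "2 * w * csqrt x = 2 * u" by (simp add: u_def)
  define R where "R = (\<lambda>N::int. (- 1) powi N * bessel_K (z + of_int N) (2 * x) *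
       (bessel_I (of_int (2 * N)) (2 * u) + bessel_J (of_int (2 * N)) (2 * u)))"
  have "((\<lambda>m. T (m, nat (int m + N))) has_sum pi * R N) {m. int m + N \<ge> 0}" for N
  proof -
    define K where "K = (- 1) powi N * (2 * pi * bessel_K (z + of_int N) (2 * x))"
    have T_eq: "T (m, nat (int m + N)) = K * ((u\<^sup>2) ^ (m + nat (int m + N)) / (fact (2 * m) * fact (2 * nat (int m + N))))"
      if "int m + N \<ge> 0" for m
    proof -
      have "int (nat (int m + N)) - int m = N" using that by simp
      thus ?thesis unfolding T_def case_prod_conv f_integral coeff_def K_def uq
        by (simp only: mult_ac)
    qed
    have hs: "((\<lambda>m. K * ((u\<^sup>2) ^ (m + nat (int m + N)) / (fact (2 * m) * fact (2 * nat (int m + N)))))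
        has_sum K * ((bessel_I (of_int (2 * N)) (2 * u) + bessel_J (of_int (2 * N)) (2 * u)) / 2)) {m. int m + N \<ge> 0}"
      by (rule has_sum_cmult_right[OF bessel_series_diagonal])
    have val: "K * ((bessel_I (of_int (2 * N)) (2 * u) + bessel_J (of_int (2 * N)) (2 * u)) / 2) = pi * R N"
      by (simp add: K_def R_def)
    show ?thesis
      by (rule has_sum_cong[THEN iffD2, OF _ hs[unfolded val]]) (use T_eq in auto)
  qed
  from has_sum_by_diagonals[OF T_sum this]
  have "((\<lambda>N. pi * R N) has_sum (LINT t|lborel. F t)) UNIV" .
  from has_sum_cmult_right[OF this, of "1 / pi"]
  have R_sum: "(R has_sum (1 / pi * (LINT t|lborel. F t))) UNIV" by simp
  have "gen_bessel_K c z w (2 * x) = 1 / 2 * (1 / pi * (LINT t|lborel. F t))"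
    unfolding gen_bessel_K_def F_def by simp
  also have "\<dots> = 1 / 2 * infsum R UNIV" using infsumI[OF R_sum] by simp
  finally show ?thesis
    using F_int has_sum_imp_summable[OF R_sum] unfolding F_def R_def u2 by blast
qed

end
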